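(* Let $m$ be a quasi-Bernoulli measure on $[0,1)^D$ with dimension $d=-\tau'(1)$, and let $\chi(q)=\tau(1-q)-qd$. Suppose that there exists a constant $C>0$ such that $$\forall q\in[-1,0),\quad 0<\chi(q)\le C\,\chi(q/2).$$ Then, $m$-almost surely, $$\liminf_{n\to+\infty}\frac{S_n-nd}{\theta(n)}\le-1,$$ where $\theta(t)=\frac{-1}{\chi^{-1}(1/t)}$ (for $t\ge1/\chi(-1)$) and $\chi^{-1}:[0,\chi(-1)]\to[-1,0]$ is the inverse function of $\chi$ restricted to $[-1,0]$. As a consequence, for all $0<a<1$, $$m\perp\mathcal H^{\psi_a},\quad\text{where }\psi_a(t)=t^d\,\ell^{a\theta(\log_\ell(1/t))}\ (t>0\text{ small}).$$ In particular, $m$ is singular with respect to $\mathcal H^d$.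
   Context: Fix integers $D\ge1$, $\ell\ge2$. $\mathcal F_n$ is the family of $\ell$-adic cubes $\prod_{i=1}^D[k_i/\ell^n,(k_i+1)/\ell^n)$, $0\le k_i<\ell^n$. For each $n$ the cubes of $\mathcal F_n$ are coded bijectively as $I_{\varepsilon_1\cdots\varepsilon_n}$, $\varepsilon_i\in\{0,\dots,\ell^D-1\}$, with $I_{\varepsilon_1\cdots\varepsilon_{n+1}}\subset I_{\varepsilon_1\cdots\varepsilon_n}$. For $I=I_{\varepsilon_1\cdots\varepsilon_n}\in\mathcal F_n$ and $J=I_{\varepsilon_{n+1}\cdots\varepsilon_{n+p}}\in\mathcal F_p$, let $IJ=I_{\varepsilon_1\cdots\varepsilon_{n+p}}\in\mathcal F_{n+p}$. A Borel probability measure $m$ on $[0,1)^D$ is quasi-Bernoulli if there is a constant $C\ge1$ with $\frac1Cm(I)m(J)\le m(IJ)\le C\,m(I)m(J)$ for all $I,J\in\bigcup_n\mathcal F_n$. The $L^q$-spectrum is $\tau(q)=\limsup_{n\to\infty}\frac{1}{n\log\ell}\log\left(\sum_{I\in\mathcal F_n}m(I)^q\right)$, $q\in\mathbb R$ (sum over cubes with $m(I)>0$). For quasi-Bernoulli $m$ it is known that $\tau$ is convex and $C^1$ on $\mathbb R$, and that $d=-\tau'(1)$ is the dimension of $m$. $I_n(x)$ is the cube of $\mathcal F_n$ containing $x$, and $S_n(x)=-\log_\ell m(I_n(x))$. Generalized Hausdorff measure: for a positive function $\Psi$ defined for small $t>0$, $\mathcal H^\Psi(E)=\lim_{\eta\to0}\inf\{\sum_i\Psi(|U_i|):E\subset\bigcup_iU_i,\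 0<|U_i|\le\eta\}$ (countable covers, $|U|$ the diameter of $U$); $\mathcal H^s$ denotes $\mathcal H^\Psi$ with $\Psi(t)=t^s$. $m\perp\mathcal H^\Psi$ (singular) means: there is a Borel set $E$ with $m(E)=1$ and $\mathcal H^\Psi(E)=0$. *)

theory Defs
  imports "HOL-Probability.Probability"
begin

section \<open>Adic cubes and their coding by words\<close>

definition unit_cube :: "(real^'D) set" where
  "unit_cube = {x. \<forall>i. 0 \<le> x $ i \<and> x $ i < 1}"

definition adic_cube :: "nat \<Rightarrow> nat \<Rightarrow> ('D \<Rightarrow> nat) \<Rightarrow> (real^'D) set" where
  "adic_cube l n k = {x. \<forall>i. real (k i) / real l ^ n \<le> x $ i \<and> x $ i < (real (k i) + 1) / real l ^ n}"

definition adic_cubes :: "nat \<Rightarrow> nat \<Rightarrow> (real^'D) set set" where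
  "adic_cubes l n = {adic_cube l n k | k. \<forall>i. k i < l ^ n}"

definition cube_at :: "nat \<Rightarrow> nat \<Rightarrow> real^'D \<Rightarrow> (real^'D) set" where
  "cube_at l n x = (THE I. I \<in> adic_cubes l n \<and> x \<in> I)"

definition words :: "nat \<Rightarrow> nat \<Rightarrow> nat list set" where
  "words b n = {w. length w = n \<and> set w \<subseteq> {..<b}}"

text \<open>
  The concatenation of cubes, and hence the quasi-Bernoulli property, depends on the choice of
  the coding, which is an arbitrary one with the following properties. If \<open>I = code u\<close> and
  \<open>J = code v\<close>, then the cube \<open>IJ\<close> is \<open>code (u @ v)\<close>.
\<close>

definition cube_coding :: "nat \<Rightarrow> (nat list \<Rightarrow> (real^'D) set) \<Rightarrow> bool" where
  "cube_coding l code \<longleftrightarrow>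
     (\<forall>n. bij_betw code (words (l ^ CARD('D)) n) (adic_cubes l n)) \<and>
     (\<forall>n. \<forall>w\<in>words (l ^ CARD('D)) n. \<forall>e<l ^ CARD('D). code (w @ [e]) \<subseteq> code w)"

section \<open>Quasi-Bernoulli measures\<close>

definition quasi_bernoulli ::
    "nat \<Rightarrow> (nat list \<Rightarrow> (real^'D) set) \<Rightarrow> (real^'D) measure \<Rightarrow> bool" where
  "quasi_bernoulli l code m \<longleftrightarrow>
     prob_space m \<and> sets m = sets (restrict_space borel unit_cube) \<and>
     (\<exists>C\<ge>1. \<forall>n p. \<forall>u\<in>words (l ^ CARD('D)) n. \<forall>v\<in>words (l ^ CARD('D)) p.
        1 / C * measure m (code u) * measure m (code v) \<le> measure m (code (u @ v)) \<and>
        measure m (code (u @ v)) \<le> C * measure m (code u) * measure m (code v))"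

text \<open>
  The upper limit is taken in the extended reals; for quasi-Bernoulli measures it is finite, so
  that the conversion to a real number loses nothing.
\<close>

definition lq_spectrum :: "nat \<Rightarrow> (real^'D) measure \<Rightarrow> real \<Rightarrow> real" where
  "lq_spectrum l m q =
     real_of_ereal (limsup (\<lambda>n. ereal (1 / (real n * ln (real l)) *
       ln (\<Sum>I | I \<in> adic_cubes l n \<and> measure m I > 0. measure m I powr q))))"

definition measure_dim :: "nat \<Rightarrow> (real^'D) measure \<Rightarrow> real" where
  "measure_dim l m = - deriv (lq_spectrum l m) 1"

definition chi :: "nat \<Rightarrow> (real^'D) measure \<Rightarrow> real \<Rightarrow> real" where
  "chi l m q = lq_spectrum l m (1 - q) - q * measure_dim l m"

text \<open>Only the values \<open>theta l m t\<close> for \<open>t \<ge> 1 / chi l m (-1)\<close> are meaningful.\<close>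

definition theta :: "nat \<Rightarrow> (real^'D) measure \<Rightarrow> real \<Rightarrow> real" where
  "theta l m t = -1 / the_inv_into {-1..0} (chi l m) (1 / t)"

definition log_mass :: "nat \<Rightarrow> (real^'D) measure \<Rightarrow> nat \<Rightarrow> real^'D \<Rightarrow> real" where
  "log_mass l m n x = - log (real l) (measure m (cube_at l n x))"

section \<open>Generalized Hausdorff measures\<close>

text \<open>
  The sets of a cover have to be required to be bounded because \<^const>\<open>diameter\<close> is unspecified
  on unbounded sets. The infimum increases as \<open>\<eta>\<close> decreases to \<open>0\<close>, hence the limit exists, and
  it depends only on the values of the gauge function \<open>\<Psi>\<close> at small positive arguments.
\<close>

definition hausdorff_premeasure ::
    "(real \<Rightarrow> real) \<Rightarrow> real \<Rightarrow> 'a::metric_space set \<Rightarrow> ennreal" where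
  "hausdorff_premeasure \<Psi> \<eta> E =
     (INF \<U> \<in> {\<U>. countable \<U> \<and> E \<subseteq> \<Union>\<U> \<and>
                   (\<forall>U\<in>\<U>. bounded U \<and> 0 < diameter U \<and> diameter U \<le> \<eta>)}.
        \<Sum>\<^sub>\<infinity>U\<in>\<U>. ennreal (\<Psi> (diameter U)))"

definition hausdorff_measure :: "(real \<Rightarrow> real) \<Rightarrow> 'a::metric_space set \<Rightarrow> ennreal" where
  "hausdorff_measure \<Psi> E = Lim (at_right 0) (\<lambda>\<eta>. hausdorff_premeasure \<Psi> \<eta> E)"

text \<open>Singularity of a Borel probability measure with respect to a Hausdorff measure.\<close>

definition hausdorff_singular :: "'a::metric_space measure \<Rightarrow> (real \<Rightarrow> real) \<Rightarrow> bool" where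
  "hausdorff_singular m \<Psi> \<longleftrightarrow> (\<exists>E\<in>sets m. measure m E = 1 \<and> hausdorff_measure \<Psi> E = 0)"

end

theory Submission
  imports Defs "HOL-Real_Asymp.Real_Asymp"
begin

text \<open>
  Write \<open>X\<^sub>n = S\<^sub>n - n d\<close>, where \<open>S\<^sub>n\<close> is \<^const>\<open>log_mass\<close>. The moment of order \<open>- s\<close> of \<open>l powr X\<^sub>n\<close> is the
  partition sum of \<open>measure m I powr (1 + s)\<close>, multiplied by \<open>l powr (s * n * d)\<close>. For a quasi-Bernoulli
  measure the partition sums are almost multiplicative in \<open>n\<close>, so that by \<open>almost_additive_linear\<close> this
  moment equals \<open>l powr (n * chi (- s))\<close> up to a constant factor, uniformly in \<open>n\<close> and in \<open>s\<close> between 0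
  and 1. Taking \<open>s\<close> with \<open>chi (- s) = M / n\<close> makes the moment of order \<open>- s\<close> comparable to \<open>l powr M\<close>; the
  doubling condition bounds the moment of order \<open>- 2 s\<close> as well, and the Paley--Zygmund inequality
  produces a probability, bounded below in \<open>n\<close>, of the event \<open>X\<^sub>n \<le> - (M - const) / s\<close>. Since
  \<open>chi\<close> is convex, \<open>M / s\<close> is at least \<open>\<theta> n\<close>. As \<open>M\<close> can be taken as large as desired, for every
  \<open>\<beta> < 1\<close> the event \<open>X\<^sub>n \<le> - \<beta> * \<theta> n\<close> has probability bounded below (lemma \<open>heavy_mass\<close>).

  The quasi-Bernoulli property transports this bound into every cube, with a lower bound for the
  conditional probability that is the same for all cubes (\<open>heavy_mass_within_cube\<close>). A Borel set that
  occupies at least a fixed fraction of each cube has full measure (\<open>full_measure_of_cube_density\<close>).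
  Therefore almost every point has \<open>X\<^sub>n \<le> - \<beta> * \<theta> n\<close> infinitely often, for every \<open>\<beta> < 1\<close>, which is the
  statement about the lower limit.

  For the singularity take \<open>a < \<beta> < 1\<close>. The set of points just described is covered by cubes of
  arbitrarily late generations whose measure is at least \<open>l powr (\<beta> * \<theta> n - n * d)\<close>, which is much more than
  the gauge function at their diameter because \<open>\<theta> n\<close> tends to infinity. Keeping only the maximal ones
  makes the cover disjoint, so that the sum of the gauge values is as small as desired.
\<close>

section \<open>Almost additive sequences and inequalities for finite sums\<close>

text \<open>
  Comparing \<open>a (k * n)\<close> with both \<open>k * a n\<close> and \<open>n * a k\<close> shows that \<open>a n / n\<close> and \<open>a k / k\<close>
  differ by at most \<open>K / n + K / k\<close>. So the slopes form a Cauchy sequence, and the error \<open>K / n\<close> that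
  remains as \<open>k\<close> tends to infinity is a bound on \<open>a n - n * L\<close> that does not depend on \<open>n\<close>.
\<close>

lemma almost_additive_linear:
  fixes a :: "nat \<Rightarrow> real"
  assumes aa: "\<And>n k. \<bar>a (n + k) - a n - a k\<bar> \<le> K"
  obtains L where "(\<lambda>n. a n / n) \<longlonglongrightarrow> L" "\<And>n. \<bar>a n - n * L\<bar> \<le> K"
proof -
  have K0: "K \<ge> 0" using aa[of 0 0] by linarith
  have mult: "\<bar>a (k * n) - k * a n\<bar> \<le> k * K" if "k > 0" for k n
    using that
  proof (induction k rule: nat_induct_non_zero)
    case 1 show ?case using K0 by simp
  next
    case (Suc k)
    have "\<bar>a (n + k * n) - a n - a (k * n)\<bar> \<le> K" by (rule aa)
    with Suc.IH show ?case by (simp add: algebra_simps abs_le_iff)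
  qed
  have le: "\<bar>a n / n - a (k * n) / (k * n)\<bar> \<le> K / n" if "k > 0" "n > 0" for k n
  proof -
    have "a n / n - a (k * n) / (k * n) = - (a (k * n) - k * a n) / (k * n)"
      using that by (simp add: field_simps)
    then have "\<bar>a n / n - a (k * n) / (k * n)\<bar> = \<bar>a (k * n) - k * a n\<bar> / (k * n)"
      by (simp only: abs_divide abs_minus_cancel of_nat_mult abs_mult abs_of_nat)
    also have "\<dots> \<le> k * K / (k * n)"
      using mult[OF that(1), of n] by (intro divide_right_mono) auto
    also have "\<dots> = K / n" using that by simp
    finally show ?thesis .
  qed
  have two: "\<bar>a n / n - a k / k\<bar> \<le> K / n + K / k" if "k > 0" "n > 0" for k n :: nat
    using le[of k n] le[of n k] that by (simp add: mult.commute)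
  have "Cauchy (\<lambda>n. a n / n)"
  proof (rule CauchyI)
    fix e :: real assume "e > 0"
    obtain N where N: "real N > 2 * K / e + 1" using reals_Archimedean2 by blast
    have "norm (a n / n - a k / k) < e" if "n \<ge> N" "k \<ge> N" for n k
    proof -
      have Npos: "real N > 1" using N K0 \<open>e > 0\<close> by (smt (verit) divide_nonneg_nonneg)
      have p: "k > 0" "n > 0" using that Npos by auto
      have *: "K / j < e / 2" if "j \<ge> N" for j :: nat
      proof -
        have "real j > 2 * K / e" using N that by linarith
        then have "2 * K < e * j" using \<open>e > 0\<close> by (simp add: field_simps)
        moreover have "real j > 0" using that Npos by linarith
        ultimately show ?thesis by (simp add: field_simps)
      qed
      show ?thesis
        unfolding real_norm_def using two[OF p] *[OF that(1)] *[OF that(2)] by linarith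
    qed
    then show "\<exists>N. \<forall>m\<ge>N. \<forall>n\<ge>N. norm (a m / m - a n / n) < e" by blast
  qed
  then obtain L where L: "(\<lambda>n. a n / n) \<longlonglongrightarrow> L" using Cauchy_convergent convergent_def by blast
  moreover have "\<bar>a n - n * L\<bar> \<le> K" for n
  proof (cases "n = 0")
    case True then show ?thesis using aa[of 0 0] by simp
  next
    case False
    have "(\<lambda>k. \<bar>a n / n - a k / k\<bar>) \<longlonglongrightarrow> \<bar>a n / n - L\<bar>"
      by (intro tendsto_intros L)
    moreover have "(\<lambda>k. K / n + K / real k) \<longlonglongrightarrow> K / n + 0"
      by (intro tendsto_intros lim_const_over_n)
    moreover have "\<forall>\<^sub>F k in sequentially. \<bar>a n / n - a k / k\<bar> \<le> K / n + K / k"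
      using eventually_gt_at_top[of 0] by eventually_elim (use two False in auto)
    ultimately have "\<bar>a n / n - L\<bar> \<le> K / n"
      using tendsto_le[OF sequentially_bot] by fastforce
    then have "\<bar>a n / n - L\<bar> * n \<le> K" using False by (simp add: field_simps)
    moreover have "\<bar>a n - n * L\<bar> = \<bar>a n / n - L\<bar> * n"
    proof -
      have "a n - n * L = (a n / n - L) * n" using False by (simp add: field_simps)
      then show ?thesis by (simp add: abs_mult)
    qed
    ultimately show ?thesis by simp
  qed
  ultimately show ?thesis using that by blast
qed

text \<open>
  The Paley--Zygmund inequality with threshold one half of the mean. The part of the mean \<open>A\<close> that
  comes from values below \<open>A / 2\<close> is at most \<open>A / 2\<close>; the other half is estimated by Cauchy--Schwarz.
  Total weight at most one is what makes \<open>A\<close> behave like an expectation.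
\<close>

lemma Paley_Zygmund_sum:
  fixes p f :: "'a \<Rightarrow> real"
  assumes "finite W" "\<And>w. w \<in> W \<Longrightarrow> 0 \<le> p w" "\<And>w. w \<in> W \<Longrightarrow> 0 \<le> f w" "sum p W \<le> 1"
  defines "A \<equiv> (\<Sum>w\<in>W. p w * f w)"
  shows "A\<^sup>2 \<le> 4 * (\<Sum>w | w \<in> W \<and> A / 2 \<le> f w. p w) * (\<Sum>w\<in>W. p w * (f w)\<^sup>2)"
proof -
  define V where "V = {w\<in>W. A / 2 \<le> f w}"
  have V: "V \<subseteq> W" "finite V" using assms(1) by (auto simp: V_def)
  have A0: "A \<ge> 0" unfolding A_def by (intro sum_nonneg) (simp add: assms)
  have "A = (\<Sum>w\<in>W - V. p w * f w) + (\<Sum>w\<in>V. p w * f w)"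
    unfolding A_def using V assms(1) by (simp add: sum.subset_diff)
  also have "(\<Sum>w\<in>W - V. p w * f w) \<le> (\<Sum>w\<in>W - V. p w * (A / 2))"
    by (intro sum_mono mult_left_mono) (use assms in \<open>auto simp: V_def\<close>)
  also have "\<dots> = sum p (W - V) * (A / 2)" by (simp add: sum_distrib_right)
  also have "sum p (W - V) * (A / 2) \<le> 1 * (A / 2)"
    using A0 sum_mono2[of W "W - V" p] assms by (intro mult_right_mono) auto
  finally have "A / 2 \<le> (\<Sum>w\<in>V. p w * f w)" by simp
  then have "(A / 2)\<^sup>2 \<le> (\<Sum>w\<in>V. p w * f w)\<^sup>2" using A0 by (intro power_mono) auto
  also have "(\<Sum>w\<in>V. p w * f w) = (\<Sum>w\<in>V. sqrt (p w) * (sqrt (p w) * f w))"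
    using V assms(2) by (intro sum.cong) (auto simp: mult.assoc[symmetric])
  also have "\<dots>\<^sup>2 \<le> (\<Sum>w\<in>V. (sqrt (p w))\<^sup>2) * (\<Sum>w\<in>V. (sqrt (p w) * f w)\<^sup>2)"
    by (rule Cauchy_Schwarz_ineq_sum)
  also have "(\<Sum>w\<in>V. (sqrt (p w))\<^sup>2) = sum p V"
    using V assms(2) by (intro sum.cong) auto
  also have "(\<Sum>w\<in>V. (sqrt (p w) * f w)\<^sup>2) = (\<Sum>w\<in>V. p w * (f w)\<^sup>2)"
    using V assms(2) by (intro sum.cong) (auto simp: power_mult_distrib)
  also have "sum p V * (\<Sum>w\<in>V. p w * (f w)\<^sup>2) \<le> sum p V * (\<Sum>w\<in>W. p w * (f w)\<^sup>2)"
    using V assms by (intro mult_left_mono sum_mono2 sum_nonneg) auto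
  finally show ?thesis by (simp add: V_def power2_eq_square)
qed

text \<open>
  The constant depends on the exponent only through its modulus, so that it stays bounded when the
  exponent ranges over a bounded set; this uniformity is essential in the moment bounds below, where
  the exponent varies with the generation.
\<close>

lemma powr_of_comparable:
  fixes C y z p :: real
  assumes "C \<ge> 1" "0 \<le> z" "1 / C * z \<le> y" "y \<le> C * z"
  shows "C powr - \<bar>p\<bar> * z powr p \<le> y powr p" "y powr p \<le> C powr \<bar>p\<bar> * z powr p"
proof -
  have "C powr - \<bar>p\<bar> * z powr p \<le> y powr p \<and> y powr p \<le> C powr \<bar>p\<bar> * z powr p"
  proof (cases "z = 0")
    case True
    then have "y = 0" using assms by simp
    then show ?thesis using True by simp
  next
    case False
    then have z: "z > 0" "C > 0" using assms by auto
    then have "1 / C * z > 0" by simp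
    then have pos: "z > 0" "y > 0" "C > 0" using z assms(3) by linarith+
    have "ln y \<le> ln (C * z)" "ln (1 / C * z) \<le> ln y"
      using assms pos by (auto simp del: times_divide_eq_left)
    then have "\<bar>ln y - ln z\<bar> \<le> ln C"
      using pos by (simp add: ln_mult ln_div)
    then have "\<bar>p\<bar> * \<bar>ln y - ln z\<bar> \<le> \<bar>p\<bar> * ln C" by (intro mult_left_mono) auto
    then have "\<bar>p * ln y - p * ln z\<bar> \<le> \<bar>p\<bar> * ln C"
      by (simp add: abs_mult[symmetric] right_diff_distrib)
    then have "exp (- \<bar>p\<bar> * ln C + p * ln z) \<le> exp (p * ln y)"
        "exp (p * ln y) \<le> exp (\<bar>p\<bar> * ln C + p * ln z)"
      unfolding exp_le_cancel_iff abs_le_iff by linarith+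
    then show ?thesis using pos by (simp only: powr_def exp_add) simp
  qed
  then show "C powr - \<bar>p\<bar> * z powr p \<le> y powr p" "y powr p \<le> C powr \<bar>p\<bar> * z powr p"
    by auto
qed

text \<open>
  Hoelder's inequality, in the form in which the spectrum needs it: dividing by the exponential of
  the claimed bound turns the inequality into the convexity of the exponential function, summed over
  the index set.
\<close>

lemma ln_sum_powr_convex:
  fixes f :: "'a \<Rightarrow> real"
  assumes "finite W" "\<And>w. w \<in> W \<Longrightarrow> 0 \<le> f w" "\<exists>w\<in>W. f w \<noteq> 0"
  shows "convex_on UNIV (\<lambda>p. ln (\<Sum>w\<in>W. f w powr p))"
proof (rule convex_onI)
  define S where "S p = (\<Sum>w\<in>W. f w powr p)" for p
  have S: "S p > 0" for p
  proof -
    obtain w where w: "w \<in> W" "f w \<noteq> 0" using assms(3) by blast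
    then have "0 < f w powr p" by simp
    then show ?thesis unfolding S_def
      using assms w by (intro sum_pos2[of W w]) auto
  qed
  fix t p q :: real
  assume t: "0 < t" "t < 1"
  let ?r = "(1 - t) *\<^sub>R p + t *\<^sub>R q"
  define c where "c = (1 - t) * ln (S p) + t * ln (S q)"
  have "f w powr ?r / exp c \<le> (1 - t) * (f w powr p / S p) + t * (f w powr q / S q)"
    if w: "w \<in> W" for w
  proof (cases "f w = 0")
    case False
    then have pos: "f w > 0" using assms(2)[OF w] by simp
    define x where "x = p * ln (f w) - ln (S p)"
    define y where "y = q * ln (f w) - ln (S q)"
    have "exp ((1 - t) *\<^sub>R x + t *\<^sub>R y) \<le> (1 - t) * exp x + t * exp y"
      using convex_onD[OF exp_convex, of t x y] t by auto
    moreover have "exp x = f w powr p / S p" "exp y = f w powr q / S q"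
      using pos S by (simp_all add: x_def y_def exp_diff powr_def)
    moreover have "(1 - t) *\<^sub>R x + t *\<^sub>R y = ?r * ln (f w) - c"
      by (simp add: x_def y_def c_def algebra_simps)
    ultimately show ?thesis using pos by (simp add: exp_diff powr_def)
  qed simp
  then have "(\<Sum>w\<in>W. f w powr ?r / exp c)
      \<le> (\<Sum>w\<in>W. (1 - t) * (f w powr p / S p) + t * (f w powr q / S q))"
    by (rule sum_mono)
  also have "\<dots> = (1 - t) * (S p / S p) + t * (S q / S q)"
    by (simp add: sum.distrib sum_distrib_left[symmetric] sum_divide_distrib[symmetric] S_def)
  also have "\<dots> = 1" using S[of p] S[of q] by simp
  finally have "S ?r / exp c \<le> 1" by (simp add: S_def sum_divide_distrib)
  then have "S ?r \<le> exp c" by simp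
  then have "ln (S ?r) \<le> c" using S ln_le_cancel_iff[of "S ?r" "exp c"] by simp
  then show "ln (\<Sum>w\<in>W. f w powr ?r)
      \<le> (1 - t) * ln (\<Sum>w\<in>W. f w powr p) + t * ln (\<Sum>w\<in>W. f w powr q)"
    by (simp add: S_def c_def)
qed simp

section \<open>Geometry of adic cubes\<close>

text \<open>
  The corner of a cube of a given generation is determined by any of its points. All disjointness
  properties of the cubes come from this description.
\<close>

lemma mem_adic_cube_iff_floor:
  assumes "l > 0"
  shows "x \<in> adic_cube l n k \<longleftrightarrow> (\<forall>i. \<lfloor>real l ^ n * x $ i\<rfloor> = int (k i))"
proof -
  have "real l ^ n > 0" using assms by simp
  then show ?thesis
    by (auto simp: adic_cube_def floor_eq_iff field_simps)
qed

lemma adic_cubes_unique: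
  assumes "l > 0" "I \<in> adic_cubes l n" "J \<in> adic_cubes l n" "x \<in> I" "x \<in> J"
  shows "I = J"
proof -
  from assms obtain k k' where k: "I = adic_cube l n k" and k': "J = adic_cube l n k'"
    by (auto simp: adic_cubes_def)
  have "int (k i) = int (k' i)" for i
    using assms k k' mem_adic_cube_iff_floor[OF assms(1)] by metis
  then have "k = k'" by auto
  then show ?thesis using k k' by simp
qed

lemma adic_cube_exists:
  assumes "l > 0" "x \<in> unit_cube"
  shows "\<exists>I\<in>adic_cubes l n. x \<in> I"
proof -
  have l: "real l ^ n > 0" using assms by simp
  define k where "k i = nat \<lfloor>real l ^ n * x $ i\<rfloor>" for i
  have "x \<in> adic_cube l n k"
    using assms l by (auto simp: mem_adic_cube_iff_floor k_def unit_cube_def)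
  moreover have "k i < l ^ n" for i
  proof -
    have "real l ^ n * x $ i < real l ^ n * 1"
      using assms l by (intro mult_strict_left_mono) (auto simp: unit_cube_def)
    then have "\<lfloor>real l ^ n * x $ i\<rfloor> < int (l ^ n)" by (simp add: floor_less_iff)
    then have "nat \<lfloor>real l ^ n * x $ i\<rfloor> < nat (int (l ^ n))"
      using assms(1) by (subst nat_mono_iff) simp_all
    then show ?thesis unfolding k_def by (simp only: nat_int)
  qed
  ultimately show ?thesis by (auto simp: adic_cubes_def)
qed

lemma adic_cubes_subset_unit_cube:
  assumes "l > 0" "I \<in> adic_cubes l n"
  shows "I \<subseteq> unit_cube"
proof
  fix x assume "x \<in> I"
  obtain k where k: "I = adic_cube l n k" "\<And>i. k i < l ^ n"
    using assms by (auto simp: adic_cubes_def)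
  have l: "real l ^ n > 0" using assms by simp
  have "0 \<le> x $ i \<and> x $ i < 1" for i
  proof -
    have 1: "real (k i) / real l ^ n \<le> x $ i" "x $ i < (real (k i) + 1) / real l ^ n"
      using \<open>x \<in> I\<close> k by (auto simp: adic_cube_def)
    have "real (k i) + 1 \<le> real (l ^ n)" using k(2)[of i] by linarith
    then have "(real (k i) + 1) / real l ^ n \<le> 1" using l by simp
    moreover have "0 \<le> real (k i) / real l ^ n" using l by simp
    ultimately show ?thesis using 1 by linarith
  qed
  then show "x \<in> unit_cube" by (simp add: unit_cube_def)
qed

lemma Union_adic_cubes:
  assumes "l > 0"
  shows "\<Union> (adic_cubes l n) = unit_cube"
  using adic_cube_exists[OF assms] adic_cubes_subset_unit_cube[OF assms] by blast

lemma cube_at_eq: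
  assumes "l > 0" "I \<in> adic_cubes l n" "x \<in> I"
  shows "cube_at l n x = I"
  unfolding cube_at_def
  using assms adic_cubes_unique by (intro the_equality) blast+

lemma sets_half_open_box:
  fixes a b :: "real^'D"
  shows "{x. \<forall>i. a $ i \<le> x $ i \<and> x $ i < b $ i} \<in> sets borel"
proof -
  have "{x. \<forall>i. a $ i \<le> x $ i \<and> x $ i < b $ i}
      = (\<Inter>i. {x. a $ i \<le> x $ i} \<inter> {x. x $ i < b $ i})" by auto
  also have "\<dots> \<in> sets borel"
    by (intro sets.finite_INT sets.Int borel_closed borel_open closed_Collect_le open_Collect_less
        continuous_intros) auto
  finally show ?thesis .
qed

lemma borel_unit_cube: "unit_cube \<in> sets borel"
  using sets_half_open_box[of 0 1] by (simp add: unit_cube_def)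

lemma borel_adic_cube: "adic_cube l n k \<in> sets borel"
  using sets_half_open_box[of "\<chi> i. real (k i) / real l ^ n" "\<chi> i. (real (k i) + 1) / real l ^ n"]
  by (simp add: adic_cube_def)

lemma bounded_adic_cube: "bounded (adic_cube l n k)"
  and diameter_adic_cube:
    "l > 0 \<Longrightarrow> diameter (adic_cube l n k :: (real^'D) set) = sqrt (CARD('D)) / real l ^ n"
proof -
  define a :: "real^'D" where "a = (\<chi> i. real (k i) / real l ^ n)"
  define b :: "real^'D" where "b = (\<chi> i. (real (k i) + 1) / real l ^ n)"
  have c: "adic_cube l n k \<subseteq> cbox a b" "box a b \<subseteq> adic_cube l n k"
    by (auto simp: adic_cube_def a_def b_def mem_box_cart less_imp_le)
  show bd: "bounded (adic_cube l n k :: (real^'D) set)"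
    using c(1) bounded_cbox bounded_subset by blast
  assume l: "l > 0"
  then have lt: "a $ i < b $ i" for i by (simp add: a_def b_def divide_strict_right_mono)
  then have le: "\<forall>i\<in>Basis. a \<bullet> i \<le> b \<bullet> i"
    by (auto simp: Basis_vec_def inner_axis less_imp_le)
  have ne: "box a b \<noteq> {}" using lt by (auto simp: interval_eq_empty_cart not_le)
  have 1: "diameter (cbox a b) = dist a b" using le by (rule diameter_cbox)
  have "diameter (box a b) = diameter (closure (box a b))"
    by (simp add: diameter_closure)
  then have 2: "diameter (box a b) = dist a b" using ne closure_box[of a b] 1 by simp
  have "diameter (box a b) \<le> diameter (adic_cube l n k :: (real^'D) set)"
       "diameter (adic_cube l n k :: (real^'D) set) \<le> diameter (cbox a b)"
    using c bd by (auto intro!: diameter_subset)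
  then have "diameter (adic_cube l n k :: (real^'D) set) = dist a b" using 1 2 by simp
  also have "\<dots> = sqrt (CARD('D)) / real l ^ n"
    by (simp add: dist_vec_def L2_set_def a_def b_def dist_real_def diff_divide_distrib[symmetric]
        real_sqrt_mult real_sqrt_divide power_divide power2_eq_square[symmetric] del: real_sqrt_power)
  finally show "diameter (adic_cube l n k :: (real^'D) set) = sqrt (CARD('D)) / real l ^ n" .
qed

section \<open>Words and cubes of a quasi-Bernoulli measure\<close>

lemma finite_words: "finite (words b n)"
proof -
  have "words b n = {w. set w \<subseteq> {..<b} \<and> length w = n}" by (auto simp: words_def)
  then show ?thesis by (simp add: finite_lists_length_eq)
qed

lemma bij_betw_append_words:
  "bij_betw (\<lambda>(u, v). u @ v) (words b n \<times> words b k) (words b (n + k))"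
  unfolding bij_betw_def
proof
  show "inj_on (\<lambda>(u, v). u @ v) (words b n \<times> words b k)"
    by (auto simp: inj_on_def words_def)
  have "\<exists>u\<in>words b n. \<exists>v\<in>words b k. w = u @ v" if "w \<in> words b (n + k)" for w
  proof (intro bexI)
    show "w = take n w @ drop n w" by simp
    show "take n w \<in> words b n" "drop n w \<in> words b k"
      using that set_take_subset[of n w] set_drop_subset[of n w] by (auto simp: words_def)
  qed
  then show "(\<lambda>(u, v). u @ v) ` (words b n \<times> words b k) = words b (n + k)"
    by (force simp: words_def)
qed

lemma sum_words_append:
  "(\<Sum>w\<in>words b (n + k). f w) = (\<Sum>u\<in>words b n. \<Sum>v\<in>words b k. f (u @ v))"
  using sum.reindex_bij_betw[OF bij_betw_append_words[of b n k], of f]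
  by (simp add: sum.cartesian_product case_prod_unfold)

text \<open>
  The number \<open>b\<close> of digits is a parameter of its own, so that sets of words can be mentioned without
  a reference to the dimension of the ambient space, which is a type.
\<close>

locale quasi_bernoulli_measure = prob_space m
  for m :: "(real^'D) measure" +
  fixes l :: nat and code :: "nat list \<Rightarrow> (real^'D) set" and b :: nat and C :: real
  assumes l2: "l \<ge> 2"
    and b_eq: "b = l ^ CARD('D)"
    and coding: "cube_coding l code"
    and sets_m: "sets m = sets (restrict_space borel unit_cube)"
    and C1: "C \<ge> 1"
    and qb_lower: "\<And>n k u v. u \<in> words b n \<Longrightarrow> v \<in> words b k \<Longrightarrow>
        1 / C * (measure m (code u) * measure m (code v)) \<le> measure m (code (u @ v))"
    and qb_upper: "\<And>n k u v. u \<in> words b n \<Longrightarrow> v \<in> words b k \<Longrightarrow>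
        measure m (code (u @ v)) \<le> C * (measure m (code u) * measure m (code v))"
begin

abbreviation W :: "nat \<Rightarrow> nat list set" where "W \<equiv> words b"

abbreviation mass :: "nat list \<Rightarrow> real" where "mass w \<equiv> measure m (code w)"

definition Z :: "nat \<Rightarrow> real \<Rightarrow> real" where "Z n p = (\<Sum>w\<in>W n. mass w powr p)"

lemma l0: "l > 0" and lnl: "ln (real l) > 0" using l2 by auto

lemma space_m: "space m = unit_cube"
  using sets_eq_imp_space_eq[OF sets_m] by (simp add: space_restrict_space)

lemma sets_m_iff: "A \<in> sets m \<longleftrightarrow> A \<subseteq> unit_cube \<and> A \<in> sets borel"
  using borel_unit_cube sets_restrict_space_iff[of unit_cube borel A] by (auto simp: sets_m)

lemma bij_code: "bij_betw code (W n) (adic_cubes l n)"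
  using coding by (simp add: cube_coding_def b_eq)

lemma finite_adic_cubes: "finite (adic_cubes l n :: (real^'D) set set)"
  using bij_betw_finite[OF bij_code] finite_words by blast

lemma code_adic: "w \<in> W n \<Longrightarrow> code w \<in> adic_cubes l n"
  using bij_code by (auto simp: bij_betw_def)

lemma sets_adic: "I \<in> adic_cubes l n \<Longrightarrow> I \<in> sets m"
proof -
  assume I: "I \<in> adic_cubes l n"
  then have "I \<in> sets borel" using borel_adic_cube by (auto simp: adic_cubes_def)
  with adic_cubes_subset_unit_cube[OF l0 I] show ?thesis by (simp add: sets_m_iff)
qed

lemma sets_code[measurable]: "w \<in> W n \<Longrightarrow> code w \<in> sets m"
  using code_adic sets_adic by blast

lemma code_append_subset:
  assumes "u \<in> W n" "v \<in> W k"
  shows "code (u @ v) \<subseteq> code u"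
  using assms(2)
proof (induction v arbitrary: k rule: rev_induct)
  case (snoc e v)
  then have v: "v \<in> W (length v)" "e < b" by (auto simp: words_def)
  then have "u @ v \<in> W (n + length v)" using assms by (auto simp: words_def)
  then have "code ((u @ v) @ [e]) \<subseteq> code (u @ v)"
    using coding v(2) unfolding cube_coding_def b_eq by blast
  with snoc.IH[OF v(1)] show ?case by simp
qed simp

lemma code_disjoint:
  assumes "u \<in> W n" "v \<in> W n" "u \<noteq> v"
  shows "code u \<inter> code v = {}"
proof (rule ccontr)
  assume "code u \<inter> code v \<noteq> {}"
  then obtain x where "x \<in> code u" "x \<in> code v" by blast
  then have "code u = code v"
    using adic_cubes_unique[OF l0 code_adic code_adic] assms by blast
  then show False using assms bij_code[of n] by (auto simp: bij_betw_def inj_on_def)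
qed

lemma measure_UN_code:
  assumes "V \<subseteq> W n"
  shows "measure m (\<Union>w\<in>V. code w) = (\<Sum>w\<in>V. mass w)"
  using assms code_disjoint[of _ n] finite_subset[OF assms finite_words]
  by (intro finite_measure_finite_Union) (auto simp: disjoint_family_on_def intro!: sets_code)

lemma UN_code: "(\<Union>w\<in>W n. code w) = unit_cube"
  using Union_adic_cubes[OF l0, of n] bij_code[of n] by (auto simp: bij_betw_def)

lemma sum_mass: "(\<Sum>w\<in>W n. mass w) = 1"
  using measure_UN_code[of "W n" n] UN_code[of n] prob_space by (simp add: space_m)

text \<open>
  The coding forces the nesting: a cube of generation \<open>k\<close> lies in the cube coded by the prefix of
  length \<open>n\<close> of its code, and only one cube of generation \<open>n\<close> can meet it.
\<close>

lemma adic_cubes_nested: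
  fixes I J :: "(real^'D) set"
  assumes "I \<in> adic_cubes l n" "J \<in> adic_cubes l k" "n \<le> k" "I \<inter> J \<noteq> {}"
  shows "J \<subseteq> I"
proof -
  obtain w where w: "w \<in> W k" "J = code w"
    using assms(2) bij_code[of k] by (auto simp: bij_betw_def)
  have "w \<in> (\<lambda>(u, v). u @ v) ` (W n \<times> W (k - n))"
    using w(1) assms(3) bij_betw_imp_surj_on[OF bij_betw_append_words[of b n "k - n"]] by simp
  then obtain u v where uv: "u \<in> W n" "v \<in> W (k - n)" "w = u @ v" by auto
  have "J \<subseteq> code u" using code_append_subset[OF uv(1,2)] w uv by simp
  moreover have "code u = I"
    using assms(1,4) \<open>J \<subseteq> code u\<close> adic_cubes_unique[OF l0 code_adic[OF uv(1)]] by blast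
  ultimately show ?thesis by simp
qed

lemma small_cube_in_open:
  fixes U :: "(real^'D) set"
  assumes "open U" "x \<in> U"
  shows "\<forall>\<^sub>F n in sequentially. \<forall>I\<in>adic_cubes l n. x \<in> I \<longrightarrow> I \<subseteq> U"
proof -
  obtain e where e: "e > 0" "ball x e \<subseteq> U" using assms openE by blast
  have "(\<lambda>n. sqrt (CARD('D)) / real l ^ n) \<longlonglongrightarrow> 0"
    using l2 by (intro LIMSEQ_divide_realpow_zero) auto
  then have "\<forall>\<^sub>F n in sequentially. sqrt (CARD('D)) / real l ^ n < e"
    using e(1) by (rule order_tendstoD)
  then show ?thesis
  proof eventually_elim
    case (elim n)
    show ?case
    proof (intro ballI impI)
      fix I :: "(real^'D) set" assume I: "I \<in> adic_cubes l n" "x \<in> I"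
      then obtain k where k: "I = adic_cube l n k" by (auto simp: adic_cubes_def)
      have "dist x y < e" if "y \<in> I" for y
        using diameter_bounded_bound[OF bounded_adic_cube[of l n k], of x y] that I
          diameter_adic_cube[OF l0, where n = n and k = k] elim by (simp add: k)
      then show "I \<subseteq> U" using e by auto
    qed
  qed
qed

lemma open_approximation_by_cubes:
  fixes U :: "(real^'D) set"
  assumes "open U"
  defines "V \<equiv> \<lambda>n. \<Union>w\<in>{w \<in> W n. code w \<subseteq> U}. code w"
  shows "incseq V" "(\<Union>n. V n) = U \<inter> unit_cube"
proof -
  show "incseq V"
  proof (rule incseq_SucI, rule subsetI)
    fix n x assume "x \<in> V n"
    then obtain w where w: "w \<in> W n" "code w \<subseteq> U" "x \<in> code w" by (auto simp: V_def)
    then have "x \<in> unit_cube" using UN_code by blast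
    then obtain w' where w': "w' \<in> W (Suc n)" "x \<in> code w'" using UN_code by blast
    have "code w' \<subseteq> code w"
      using w w' by (intro adic_cubes_nested[OF code_adic code_adic]) auto
    then show "x \<in> V (Suc n)" using w w' by (auto simp: V_def)
  qed
  show "(\<Union>n. V n) = U \<inter> unit_cube"
  proof
    show "(\<Union>n. V n) \<subseteq> U \<inter> unit_cube" using UN_code by (auto simp: V_def)
    show "U \<inter> unit_cube \<subseteq> (\<Union>n. V n)"
    proof
      fix x assume x: "x \<in> U \<inter> unit_cube"
      then obtain n where n: "\<forall>I\<in>adic_cubes l n. x \<in> I \<longrightarrow> I \<subseteq> U"
        using eventually_happens[OF small_cube_in_open[OF assms(1)]] by auto
      obtain w where "w \<in> W n" "x \<in> code w" using x UN_code by blast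
      then have "x \<in> V n" using n code_adic by (auto simp: V_def)
      then show "x \<in> (\<Union>n. V n)" by blast
    qed
  qed
qed

text \<open>
  A substitute for the Lebesgue density theorem. The complement \<open>N\<close> of \<open>H\<close> occupies at most the
  fraction \<open>1 - p\<close> of every cube, hence of every open set, because inside of the unit cube an open set
  is an increasing union of finite disjoint unions of cubes. Open sets that contain \<open>N\<close> and have almost the measure of \<open>N\<close>
  then give \<open>measure m N \<le> (1 - p) * measure m N\<close>. Together with the quasi-Bernoulli property this
  plays the part of a zero-one law.
\<close>

lemma full_measure_of_cube_density:
  assumes H: "H \<in> sets m" and "p > 0"
    and dens: "\<And>n u. u \<in> W n \<Longrightarrow> p * mass u \<le> measure m (H \<inter> code u)"
  shows "measure m H = 1"
proof -
  define N where "N = unit_cube - H"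
  have N: "N \<in> sets m" using H unfolding N_def space_m[symmetric] by auto
  have p1: "p \<le> 1"
  proof -
    have nil: "[] \<in> W 0" by (simp add: words_def)
    have "W 0 = {[]}" by (auto simp: words_def)
    then have "mass [] = 1" using sum_mass[of 0] by simp
    then have "p \<le> measure m (H \<inter> code [])" using dens[OF nil] by simp
    then show ?thesis using prob_le_1 by (rule order_trans)
  qed
  have N_code: "measure m (N \<inter> code u) \<le> (1 - p) * mass u" if u: "u \<in> W n" for u n
  proof -
    have "mass u = measure m (H \<inter> code u) + measure m (N \<inter> code u)"
      using u H N UN_code[of n]
      by (subst finite_measure_Union[symmetric]) (auto simp: N_def intro!: arg_cong[where f = "measure m"])
    then show ?thesis using dens[OF u] by (simp add: algebra_simps)
  qed
  have N_open: "measure m N \<le> (1 - p) * measure m (U \<inter> unit_cube)" if U: "open U" "N \<subseteq> U" for U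
  proof -
    define V where "V n = (\<Union>w\<in>{w \<in> W n. code w \<subseteq> U}. code w)" for n
    have V: "incseq V" "(\<Union>n. V n) = U \<inter> unit_cube"
      using open_approximation_by_cubes[OF U(1)] unfolding V_def by blast+
    have fin: "finite {w \<in> W n. code w \<subseteq> U}" for n using finite_words by simp
    have Vs: "V n \<in> sets m" for n unfolding V_def using fin by auto
    have le: "measure m (N \<inter> V n) \<le> (1 - p) * measure m (V n)" for n
    proof -
      have "N \<inter> V n = (\<Union>w\<in>{w \<in> W n. code w \<subseteq> U}. N \<inter> code w)" by (auto simp: V_def)
      also have "measure m \<dots> \<le> (\<Sum>w | w \<in> W n \<and> code w \<subseteq> U. measure m (N \<inter> code w))"
        using fin N by (intro measure_UNION_le) auto
      also have "\<dots> \<le> (\<Sum>w | w \<in> W n \<and> code w \<subseteq> U. (1 - p) * mass w)"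
        by (intro sum_mono N_code) auto
      also have "\<dots> = (1 - p) * measure m (V n)"
        unfolding V_def by (subst measure_UN_code[of _ n]) (auto simp: sum_distrib_left)
      finally show ?thesis .
    qed
    have "(\<lambda>n. measure m (V n)) \<longlonglongrightarrow> measure m (\<Union>n. V n)"
      using V Vs by (intro finite_Lim_measure_incseq) auto
    moreover have "(\<lambda>n. measure m (N \<inter> V n)) \<longlonglongrightarrow> measure m (\<Union>n. N \<inter> V n)"
      using V Vs N by (intro finite_Lim_measure_incseq) (auto simp: incseq_def)
    moreover have "(\<Union>n. N \<inter> V n) = N" using V(2) U by (auto simp: N_def)
    ultimately show ?thesis
      using V(2) le by (intro LIMSEQ_le[of _ "measure m N" "\<lambda>n. (1 - p) * measure m (V n)"])
        (auto intro!: tendsto_mult_left)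
  qed
  \<comment> \<open>Regularity of Borel measures is available on the whole space, so the measure is extended
    by zero outside of the unit cube.\<close>
  define m' where "m' = distr m borel (\<lambda>x. x)"
  have id: "(\<lambda>x. x) \<in> measurable m borel"
  proof (rule measurableI)
    fix A :: "(real^'D) set" assume "A \<in> sets borel"
    then have "A \<inter> unit_cube \<in> sets m" using borel_unit_cube by (auto simp: sets_m_iff)
    then show "(\<lambda>x. x) -` A \<inter> space m \<in> sets m" by (simp add: space_m)
  qed auto
  have em: "emeasure m' A = ennreal (measure m (A \<inter> unit_cube))" if "A \<in> sets borel" for A
    using that id by (simp add: m'_def emeasure_distr space_m emeasure_eq_measure)
  have Nb: "N \<in> sets borel" "N \<inter> unit_cube = N" using N by (auto simp: sets_m_iff N_def)
  have "measure m N \<le> 0"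
  proof (rule ccontr)
    assume "\<not> measure m N \<le> 0"
    then have pos: "measure m N > 0" by simp
    define e where "e = p * measure m N / 2"
    have e: "e > 0" using pos \<open>p > 0\<close> by (simp add: e_def)
    have "emeasure m' (space m') \<noteq> \<infinity>" by (simp add: m'_def em[unfolded m'_def])
    then have "emeasure m' N = (INF U \<in> {U. N \<subseteq> U \<and> open U}. emeasure m' U)"
      using Nb by (intro outer_regular) (auto simp: m'_def)
    moreover have "emeasure m' N < ennreal (measure m N + e)"
      using e by (simp add: em Nb ennreal_less_iff)
    ultimately have "(INF U \<in> {U. N \<subseteq> U \<and> open U}. emeasure m' U) < ennreal (measure m N + e)"
      by simp
    then obtain U where U: "N \<subseteq> U" "open U" "emeasure m' U < ennreal (measure m N + e)"
      by (auto simp: INF_less_iff)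
    then have "measure m (U \<inter> unit_cube) < measure m N + e"
      by (simp add: em ennreal_less_iff)
    then have "(1 - p) * measure m (U \<inter> unit_cube) \<le> (1 - p) * (measure m N + e)"
      using p1 by (intro mult_left_mono) auto
    moreover have "p * e > 0" using e \<open>p > 0\<close> by simp
    ultimately have "p * measure m N < e"
      using N_open[OF U(2,1)] by (simp add: algebra_simps)
    then show False using pos \<open>p > 0\<close> by (simp add: e_def)
  qed
  then have "measure m N = 0" using measure_nonneg[of m N] by linarith
  then show ?thesis using prob_compl[OF H] by (simp add: N_def space_m)
qed

section \<open>Partition sums and the spectrum\<close>

lemma ex_mass_nonzero: "\<exists>w\<in>W n. mass w \<noteq> 0"
proof (rule ccontr)
  assume "\<not> ?thesis"
  then have "(\<Sum>w\<in>W n. mass w) = 0" by (intro sum.neutral) auto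
  then show False using sum_mass[of n] by simp
qed

lemma Z_pos: "Z n p > 0"
proof -
  obtain w where w: "w \<in> W n" "mass w \<noteq> 0" using ex_mass_nonzero by blast
  then have "0 < mass w powr p" by simp
  then show ?thesis unfolding Z_def
    using w by (intro sum_pos2[OF finite_words w(1)]) auto
qed

lemma Z_1: "Z n 1 = 1"
  by (simp add: Z_def sum_mass)

text \<open>
  Splitting words at position \<open>n\<close> turns the quasi-Bernoulli inequalities into inequalities between
  the partition functions.
\<close>

lemma Z_almost_multiplicative:
  "C powr - \<bar>p\<bar> * (Z n p * Z k p) \<le> Z (n + k) p" "Z (n + k) p \<le> C powr \<bar>p\<bar> * (Z n p * Z k p)"
proof -
  have *: "c * (Z n p * Z k p)
      = (\<Sum>u\<in>W n. \<Sum>v\<in>W k. c * (mass u * mass v) powr p)" for c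
    unfolding Z_def sum_product by (simp add: sum_distrib_left powr_mult)
  show "C powr - \<bar>p\<bar> * (Z n p * Z k p) \<le> Z (n + k) p"
    unfolding * unfolding Z_def sum_words_append
    by (intro sum_mono powr_of_comparable C1 qb_lower qb_upper) auto
  show "Z (n + k) p \<le> C powr \<bar>p\<bar> * (Z n p * Z k p)"
    unfolding * unfolding Z_def sum_words_append
    by (intro sum_mono powr_of_comparable C1 qb_lower qb_upper) auto
qed

abbreviation tau :: "real \<Rightarrow> real" where "tau \<equiv> lq_spectrum l m"

lemma lq_sum_eq_Z: "(\<Sum>I | I \<in> adic_cubes l n \<and> measure m I > 0. measure m I powr p) = Z n p"
proof -
  have "(\<Sum>I | I \<in> adic_cubes l n \<and> measure m I > 0. measure m I powr p)
      = (\<Sum>I \<in> adic_cubes l n. measure m I powr p)"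
    using finite_adic_cubes by (intro sum.mono_neutral_left) (auto simp: zero_less_measure_iff)
  also have "\<dots> = Z n p"
    unfolding Z_def by (rule sum.reindex_bij_betw[OF bij_code, symmetric])
  finally show ?thesis .
qed

text \<open>
  Almost multiplicativity of \<open>Z\<close> makes the upper limit in the definition of the spectrum a limit and,
  more importantly, shows that \<open>Z n p\<close> equals \<open>l powr (n * tau p)\<close> up to a factor that is bounded
  independently of \<open>n\<close>.
\<close>

lemma ln_Z_limit: "(\<lambda>n. ln (Z n p) / n) \<longlonglongrightarrow> ln l * tau p"
  and ln_Z_bound: "\<bar>ln (Z n p) - n * (ln l * tau p)\<bar> \<le> \<bar>p\<bar> * ln C"
proof -
  have "\<bar>ln (Z (n + k) p) - ln (Z n p) - ln (Z k p)\<bar> \<le> \<bar>p\<bar> * ln C" for n k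
  proof -
    have ln_eq: "ln (C powr r * (Z n p * Z k p)) = r * ln C + (ln (Z n p) + ln (Z k p))" for r
      using C1 Z_pos[of n p] Z_pos[of k p] by (simp add: ln_mult ln_powr)
    have "ln (C powr - \<bar>p\<bar> * (Z n p * Z k p)) \<le> ln (Z (n + k) p)"
      using Z_almost_multiplicative(1) C1 Z_pos by (intro ln_mono mult_pos_pos) auto
    moreover have "ln (Z (n + k) p) \<le> ln (C powr \<bar>p\<bar> * (Z n p * Z k p))"
      using Z_almost_multiplicative(2) Z_pos by (intro ln_mono)
    ultimately show ?thesis unfolding ln_eq by linarith
  qed
  then obtain L where L: "(\<lambda>n. ln (Z n p) / n) \<longlonglongrightarrow> L"
      "\<And>n. \<bar>ln (Z n p) - n * L\<bar> \<le> \<bar>p\<bar> * ln C"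
    using almost_additive_linear[of "\<lambda>n. ln (Z n p)"] by blast
  have "(\<lambda>n. ereal (ln (Z n p) / n / ln l)) \<longlonglongrightarrow> ereal (L / ln l)"
    using lnl by (intro tendsto_ereal tendsto_divide L(1) tendsto_const) auto
  then have "limsup (\<lambda>n. ereal (ln (Z n p) / n / ln l)) = ereal (L / ln l)"
    by (intro lim_imp_Limsup) auto
  then have "tau p = L / ln l"
    by (simp add: lq_spectrum_def lq_sum_eq_Z mult.commute)
  then have "L = ln l * tau p" using lnl by simp
  with L show "(\<lambda>n. ln (Z n p) / n) \<longlonglongrightarrow> ln l * tau p"
    "\<bar>ln (Z n p) - n * (ln l * tau p)\<bar> \<le> \<bar>p\<bar> * ln C" by auto
qed

lemma tau_1: "tau 1 = 0"
proof -
  have "(\<lambda>n. ln (Z n 1) / n) \<longlonglongrightarrow> 0" by (simp add: Z_1)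
  then have "ln l * tau 1 = 0" using ln_Z_limit LIMSEQ_unique by blast
  then show ?thesis using lnl by simp
qed

lemma convex_tau: "convex_on UNIV tau"
proof (rule convex_onI)
  fix t p q :: real
  assume t: "0 < t" "t < 1"
  let ?r = "(1 - t) *\<^sub>R p + t *\<^sub>R q"
  have "ln (Z n ?r) \<le> (1 - t) * ln (Z n p) + t * ln (Z n q)" for n
    using convex_onD[OF ln_sum_powr_convex[of "W n" mass], of t p q]
      t finite_words ex_mass_nonzero by (auto simp: Z_def)
  then have "ln (Z n ?r) / n \<le> ((1 - t) * ln (Z n p) + t * ln (Z n q)) / n" for n
    by (intro divide_right_mono) auto
  then have "ln (Z n ?r) / n \<le> (1 - t) * (ln (Z n p) / n) + t * (ln (Z n q) / n)" for n
    by (simp add: add_divide_distrib)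
  moreover have "(\<lambda>n. (1 - t) * (ln (Z n p) / n) + t * (ln (Z n q) / n))
      \<longlonglongrightarrow> (1 - t) * (ln l * tau p) + t * (ln l * tau q)"
    by (intro tendsto_intros ln_Z_limit)
  ultimately have "ln l * tau ?r \<le> (1 - t) * (ln l * tau p) + t * (ln l * tau q)"
    by (intro LIMSEQ_le[OF ln_Z_limit]) auto
  then have "ln l * tau ?r \<le> ln l * ((1 - t) * tau p + t * tau q)"
    by (simp add: algebra_simps)
  then show "tau ?r \<le> (1 - t) * tau p + t * tau q" using lnl by simp
qed simp

end

section \<open>The inverse of the centred spectrum\<close>

locale doubling_quasi_bernoulli = quasi_bernoulli_measure m l code b C
  for m :: "(real^'D) measure" and l code b C +
  fixes K :: real
  assumes chi_pos: "\<And>q. q \<in> {-1..<0} \<Longrightarrow> 0 < chi l m q"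
    and chi_doubling: "\<And>q. q \<in> {-1..<0} \<Longrightarrow> chi l m q \<le> K * chi l m (q / 2)"
begin

abbreviation d :: real where "d \<equiv> measure_dim l m"

abbreviation \<theta> :: "real \<Rightarrow> real" where "\<theta> \<equiv> theta l m"

text \<open>
  From \<open>t0\<close> on, \<open>1 / t\<close> lies in the range of \<open>chi l m\<close> on the interval from \<open>-1\<close> to \<open>0\<close>, so that
  \<open>\<theta> t\<close> is meaningful.
\<close>

definition t0 :: real where "t0 = 1 / chi l m (-1)"

definition expo :: "real \<Rightarrow> real" where "expo t = - the_inv_into {-1..0} (chi l m) (1 / t)"

lemma t0_pos: "t0 > 0"
  using chi_pos[of "-1"] by (simp add: t0_def)

lemma chi_0: "chi l m 0 = 0"
  by (simp add: chi_def tau_1)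

lemma convex_chi: "convex_on UNIV (chi l m)"
proof (rule convex_onI)
  fix t p q :: real
  assume t: "0 < t" "t < 1"
  have "tau ((1 - t) *\<^sub>R (1 - p) + t *\<^sub>R (1 - q)) \<le> (1 - t) * tau (1 - p) + t * tau (1 - q)"
    using convex_onD[OF convex_tau, of t "1 - p" "1 - q"] t by auto
  moreover have "(1 - t) *\<^sub>R (1 - p) + t *\<^sub>R (1 - q) = 1 - ((1 - t) *\<^sub>R p + t *\<^sub>R q)"
    by (simp add: algebra_simps)
  ultimately show "chi l m ((1 - t) *\<^sub>R p + t *\<^sub>R q) \<le> (1 - t) * chi l m p + t * chi l m q"
    by (simp add: chi_def algebra_simps)
qed simp

lemma chi_scale:
  assumes "0 \<le> t" "t \<le> 1"
  shows "chi l m (t * q) \<le> t * chi l m q"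
  using convex_onD[OF convex_chi, of t 0 q] assms by (simp add: chi_0)

text \<open>
  Convexity, \<open>chi 0 = 0\<close> and positivity to the left of zero already give strict monotonicity.
\<close>

lemma chi_strict_antimono:
  assumes "-1 \<le> q" "q < r" "r \<le> 0"
  shows "chi l m r < chi l m q"
proof -
  have pos: "0 < chi l m q" using chi_pos assms by simp
  have "chi l m ((r / q) * q) \<le> (r / q) * chi l m q"
    using assms by (intro chi_scale) (auto simp: divide_simps)
  also have "\<dots> < 1 * chi l m q"
    using assms pos by (intro mult_strict_right_mono) (auto simp: divide_simps)
  finally show ?thesis using assms by simp
qed

lemma chi_le_iff:
  assumes "0 \<le> r" "r \<le> 1" "0 \<le> s" "s \<le> 1"
  shows "chi l m (- r) \<le> chi l m (- s) \<longleftrightarrow> r \<le> s"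
  using chi_strict_antimono[of "- s" "- r"] chi_strict_antimono[of "- r" "- s"] assms
  by (cases r s rule: linorder_cases) auto

lemma expo_root:
  assumes "t \<ge> t0"
  shows expo_pos: "0 < expo t" and expo_le_1: "expo t \<le> 1" and chi_expo: "chi l m (- expo t) = 1 / t"
proof -
  have t: "t > 0" using t0_pos assms by simp
  have inj: "inj_on (chi l m) {-1..0}"
    by (rule linorder_inj_onI) (use chi_strict_antimono in \<open>force+\<close>)
  have "continuous_on {-1..0} (chi l m)"
    by (rule continuous_on_subset[OF convex_on_continuous[OF open_UNIV convex_chi]]) auto
  moreover have "1 / t \<le> chi l m (-1)"
    using assms t chi_pos[of "-1"] by (simp add: t0_def field_simps)
  ultimately have "\<exists>q\<ge>-1. q \<le> 0 \<and> chi l m q = 1 / t"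
    using t chi_0 by (intro IVT2') auto
  then have im: "1 / t \<in> chi l m ` {-1..0}" by force
  have eq: "chi l m (- expo t) = 1 / t"
    using f_the_inv_into_f[OF inj im] by (simp add: expo_def)
  have "- expo t \<in> {-1..0}"
    using the_inv_into_into[OF inj im subset_refl] by (simp add: expo_def)
  moreover have "expo t \<noteq> 0" using eq chi_0 t by auto
  ultimately show "0 < expo t" "expo t \<le> 1" "chi l m (- expo t) = 1 / t"
    using eq by auto
qed

lemma theta_eq: "\<theta> t = 1 / expo t"
  by (simp add: theta_def expo_def)

lemma theta_pos: "t \<ge> t0 \<Longrightarrow> \<theta> t > 0"
  using expo_pos by (simp add: theta_eq)

lemma theta_mono:
  assumes "t0 \<le> t" "t \<le> u"
  shows "\<theta> t \<le> \<theta> u"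
proof -
  have u: "t0 \<le> u" using assms by simp
  have "1 / u \<le> 1 / t" using assms t0_pos by (intro divide_left_mono) auto
  then have "expo u \<le> expo t"
    using chi_le_iff[of "expo u" "expo t"] expo_root[OF assms(1)] expo_root[OF u] by simp
  then show ?thesis
    unfolding theta_eq using expo_pos[OF u] expo_pos[OF assms(1)] by (intro divide_left_mono) auto
qed

text \<open>
  By convexity \<open>chi\<close> at \<open>- c * s\<close> is at least \<open>c\<close> times its value at \<open>- s\<close>, so that the inverse
  function is sublinear. This inequality is used in two ways: for a large factor \<open>c\<close>, to pass from the
  normalization in which the estimates are sharp up to a constant to the one of the theorem, and for a
  factor close to one, to neglect a bounded shift of the generation.
\<close>

lemma theta_scale:
  assumes "t0 \<le> t" "1 \<le> c"
  shows "\<theta> (c * t) \<le> c * \<theta> t"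
proof -
  have t: "t > 0" using assms(1) t0_pos by simp
  have ct: "t0 \<le> c * t" using assms t mult_right_mono[of 1 c t] by linarith
  have "expo t \<le> c * expo (c * t)"
  proof (cases "c * expo (c * t) \<le> 1")
    case True
    have "chi l m ((1 / c) * (c * - expo (c * t))) \<le> (1 / c) * chi l m (c * - expo (c * t))"
      using assms by (intro chi_scale) auto
    then have "c * chi l m (- expo (c * t)) \<le> chi l m (- (c * expo (c * t)))"
      using assms by (simp add: field_simps)
    then have "chi l m (- expo t) \<le> chi l m (- (c * expo (c * t)))"
      using assms t by (simp add: chi_expo[OF ct] chi_expo[OF assms(1)])
    then show ?thesis
      using True expo_root[OF assms(1)] expo_pos[OF ct] assms by (subst (asm) chi_le_iff) auto
  next
    case False
    then show ?thesis using expo_le_1[OF assms(1)] by simp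
  qed
  then show ?thesis
    unfolding theta_eq using expo_pos[OF ct] expo_pos[OF assms(1)] by (simp add: field_simps)
qed

lemma theta_at_top: "filterlim \<theta> at_top at_top"
  unfolding filterlim_at_top
proof
  fix R :: real
  define r where "r = 1 / max R 1"
  have r: "0 < r" "r \<le> 1" by (auto simp: r_def)
  have pos: "chi l m (- r) > 0" using r by (intro chi_pos) auto
  have "R \<le> \<theta> t" if t: "t \<ge> max t0 (1 / chi l m (- r))" for t
  proof -
    have t': "t0 \<le> t" "t > 0" using t t0_pos by auto
    have "1 / t \<le> chi l m (- r)" using t t' pos by (simp add: field_simps)
    then have "expo t \<le> r"
      using chi_le_iff[of "expo t" r] r expo_root[OF t'(1)] by simp
    then have "1 / r \<le> \<theta> t"
      unfolding theta_eq using expo_pos[OF t'(1)] r by (intro divide_left_mono) auto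
    moreover have "R \<le> 1 / r" by (simp add: r_def)
    ultimately show ?thesis by linarith
  qed
  then show "\<forall>\<^sub>F t in at_top. R \<le> \<theta> t" using eventually_ge_at_top by (rule eventually_mono[rotated])
qed

lemma theta_nat_at_top: "filterlim (\<lambda>n. \<theta> (real n)) at_top sequentially"
  by (rule filterlim_compose[OF theta_at_top filterlim_real_sequentially])

section \<open>Heavy cubes\<close>

text \<open>
  If \<open>I\<close> is the cube of generation \<open>n\<close> that contains \<open>x\<close> and has positive measure, then this says
  \<open>log_mass l m n x - n * d \<le> - \<beta> * \<theta> n\<close>.
\<close>

definition heavy :: "real \<Rightarrow> nat \<Rightarrow> (real^'D) set \<Rightarrow> bool" where
  "heavy \<beta> n I \<longleftrightarrow> real l powr (\<beta> * \<theta> n - n * d) \<le> measure m I"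

lemma heavy_iff_ln: "heavy \<beta> n I \<longleftrightarrow> measure m I > 0 \<and> (\<beta> * \<theta> n - n * d) * ln l \<le> ln (measure m I)"
proof (cases "measure m I > 0")
  case True
  then show ?thesis using l0 by (simp add: heavy_def powr_def ln_ge_iff)
next
  case False
  then have "measure m I = 0" by (simp add: zero_less_measure_iff)
  then show ?thesis using l0 by (simp add: heavy_def)
qed

text \<open>
  \<open>E\<close> is the mean of \<open>l powr (- s * (log_mass l m n x - n * d))\<close>, and the factor \<open>l powr (s * n * d)\<close>
  turns the exponent \<open>tau (1 + s)\<close> of the partition function into \<open>chi l m (- s)\<close>.
\<close>

lemma moment_bounds:
  fixes s :: real and n :: nat
  assumes "0 \<le> s" "s \<le> 1"
  defines "E \<equiv> (\<Sum>w\<in>W n. mass w * (mass w powr s * real l powr (s * n * d)))"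
  shows "E > 0" "\<bar>ln E - n * chi l m (- s) * ln l\<bar> \<le> 2 * ln C"
proof -
  have "E = Z n (1 + s) * real l powr (s * n * d)"
    unfolding E_def Z_def sum_distrib_right
    by (intro sum.cong refl) (simp add: powr_mult_base[symmetric] mult.assoc)
  then have E: "E > 0" "ln E = ln (Z n (1 + s)) + s * n * d * ln l"
    using Z_pos[of n "1 + s"] l0 by (simp_all add: ln_mult ln_powr)
  have "\<bar>1 + s\<bar> * ln C \<le> 2 * ln C" using assms C1 by (intro mult_right_mono) auto
  then have "\<bar>ln (Z n (1 + s)) - n * (ln l * tau (1 + s))\<bar> \<le> 2 * ln C"
    using ln_Z_bound[of n "1 + s"] by linarith
  moreover have "ln (Z n (1 + s)) - n * (ln l * tau (1 + s)) = ln E - n * chi l m (- s) * ln l"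
    by (simp add: E(2) chi_def algebra_simps)
  ultimately show "E > 0" "\<bar>ln E - n * chi l m (- s) * ln l\<bar> \<le> 2 * ln C" using E by simp_all
qed

text \<open>
  Choose \<open>s\<close> with \<open>chi l m (- s) = M / n\<close>. The random variable
  \<open>f = l powr (- s * (log_mass l m n x - n * d))\<close> then has a mean comparable to \<open>l powr M\<close>, and by the
  doubling condition its second moment, which involves \<open>chi l m (- (2 * s))\<close>, is at most of order
  \<open>l powr (K * M)\<close>. All these bounds are free of \<open>n\<close>, so that by the Paley--Zygmund inequality \<open>f\<close> exceeds
  half its mean with a probability that is bounded away from zero. There
  \<open>log_mass l m n x - n * d\<close> is at most \<open>- (M - const) / s\<close>, and \<open>M / s = M * \<theta> (n / M) \<ge> \<theta> n\<close>. The constant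
  is harmless once \<open>M\<close> is large compared with it: this is how every \<open>\<beta> < 1\<close> is reached.
\<close>

lemma heavy_mass:
  assumes "0 < \<beta>" "\<beta> < 1"
  shows "\<exists>p>0. \<forall>\<^sub>F n in sequentially. p \<le> (\<Sum>w | w \<in> W n \<and> heavy \<beta> n (code w). mass w)"
proof -
  \<comment> \<open>This is the size of M for which the loss of 2 ln C in the moment bounds and of ln 2 in the
    threshold fits into the gap between \<beta> and 1.\<close>
  define M where "M = max 1 ((2 * ln C + ln 2) / ((1 - \<beta>) * ln l))"
  have M1: "M \<ge> 1" by (simp add: M_def)
  have "(2 * ln C + ln 2) / ((1 - \<beta>) * ln l) \<le> M" by (simp add: M_def)
  then have M: "2 * ln C + ln 2 \<le> M * ((1 - \<beta>) * ln l)"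
    using assms lnl by (subst (asm) pos_divide_le_eq) auto
  define A0 where "A0 = exp (M * ln l - 2 * ln C)"
  define B0 where "B0 = exp (K * M * ln l + 2 * ln C)"
  define p where "p = A0\<^sup>2 / (4 * B0)"
  have "p > 0" by (simp add: p_def A0_def B0_def)
  have lim: "filterlim (\<lambda>n. real n / M) at_top sequentially"
    using M1 filterlim_real_sequentially
    by (intro filterlim_at_top_mult_tendsto_pos[where f = "\<lambda>_. 1 / M" and c = "1 / M", simplified]) auto
  \<comment> \<open>This makes s at most one half, so that the second moment, of order 2 s, still involves
    only values of chi on the interval where the doubling condition is available.\<close>
  have "\<forall>\<^sub>F n in sequentially. 2 \<le> \<theta> (real n / M)"
    using filterlim_compose[OF theta_at_top lim] by (auto simp: filterlim_at_top)
  moreover have "\<forall>\<^sub>F n in sequentially. t0 \<le> real n / M"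
    using lim by (auto simp: filterlim_at_top)
  ultimately have "\<forall>\<^sub>F n in sequentially. p \<le> (\<Sum>w | w \<in> W n \<and> heavy \<beta> n (code w). mass w)"
  proof eventually_elim
    case (elim n)
    define s where "s = expo (real n / M)"
    have npos: "n > 0" using elim(2) t0_pos M1 by (cases n) auto
    have s: "0 < s" "chi l m (- s) = M / n"
      using expo_root[OF elim(2)] M1 by (auto simp: s_def)
    have s2: "s \<le> 1 / 2" using elim(1) s(1) by (simp add: theta_eq s_def field_simps)
    define f where "f w = mass w powr s * real l powr (s * n * d)" for w
    define A where "A = (\<Sum>w\<in>W n. mass w * f w)"
    define B where "B = (\<Sum>w\<in>W n. mass w * (f w)\<^sup>2)"
    have f2: "(f w)\<^sup>2 = mass w powr (2 * s) * real l powr (2 * s * n * d)" for w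
    proof -
      have "(x powr y)\<^sup>2 = x powr (2 * y)" for x y :: real
        by (simp add: power2_eq_square powr_add[symmetric])
      then show ?thesis by (simp add: f_def power_mult_distrib mult.assoc)
    qed
    have A: "A > 0" "\<bar>ln A - n * chi l m (- s) * ln l\<bar> \<le> 2 * ln C"
      using moment_bounds[of s n] s s2 by (simp_all add: A_def f_def)
    have B: "B > 0" "\<bar>ln B - n * chi l m (- (2 * s)) * ln l\<bar> \<le> 2 * ln C"
      using moment_bounds[of "2 * s" n] s s2 by (simp_all add: B_def f2)
    have lnA: "M * ln l - 2 * ln C \<le> ln A" using A(2) s npos by simp
    then have AA: "A0 \<le> A" using A(1) by (simp add: A0_def ln_ge_iff)
    have "chi l m (- (2 * s)) \<le> K * chi l m (- s)"
      using chi_doubling[of "- (2 * s)"] s s2 by simp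
    then have "n * chi l m (- (2 * s)) * ln l \<le> n * (K * chi l m (- s)) * ln l"
      using lnl by (intro mult_right_mono mult_left_mono) auto
    also have "\<dots> = K * M * ln l" using s npos by simp
    finally have "ln B \<le> K * M * ln l + 2 * ln C" using B(2) by linarith
    then have BB: "B \<le> B0" unfolding B0_def using B(1) by (metis exp_le_cancel_iff exp_ln)
    have "\<theta> (M * (real n / M)) \<le> M * \<theta> (real n / M)"
      using elim M1 by (intro theta_scale) auto
    then have th: "\<theta> n * s \<le> M" using M1 s by (simp add: theta_eq s_def[symmetric] field_simps)
    have heavy: "heavy \<beta> n (code w)" if "A / 2 \<le> f w" for w
    proof -
      have "f w > 0" using that A by simp
      then have mw: "mass w > 0" by (auto simp: f_def zero_less_measure_iff)
      have "ln A - ln 2 \<le> ln (f w)"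
        using that A(1) ln_mono[of "A / 2" "f w"] by (simp add: ln_div)
      also have "ln (f w) = s * (ln (mass w) + n * d * ln l)"
        using mw l0 by (simp add: f_def ln_mult ln_powr algebra_simps)
      finally have "M * ln l - 2 * ln C - ln 2 \<le> s * (ln (mass w) + n * d * ln l)"
        using lnA by linarith
      moreover have "\<theta> n * s * (\<beta> * ln l) \<le> M * (\<beta> * ln l)"
        using th assms lnl by (intro mult_right_mono) auto
      ultimately have "s * (\<beta> * \<theta> n * ln l) \<le> s * (ln (mass w) + n * d * ln l)"
        using M by (simp add: algebra_simps)
      then have "\<beta> * \<theta> n * ln l \<le> ln (mass w) + n * d * ln l" using s by simp
      then show ?thesis using mw by (simp add: heavy_iff_ln algebra_simps)
    qed
    define P where "P = (\<Sum>w | w \<in> W n \<and> A / 2 \<le> f w. mass w)"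
    have P0: "P \<ge> 0" by (auto simp: P_def intro: sum_nonneg)
    have "A0\<^sup>2 \<le> A\<^sup>2" using AA by (intro power_mono) (auto simp: A0_def)
    also have "\<dots> \<le> 4 * P * B"
      using Paley_Zygmund_sum[OF finite_words[of b n], where p = mass and f = f] sum_mass[of n]
      by (simp add: A_def B_def P_def f_def)
    also have "\<dots> \<le> 4 * P * B0" using BB P0 by (intro mult_left_mono) auto
    finally have "p \<le> P" unfolding p_def by (simp add: B0_def field_simps)
    also have "P \<le> (\<Sum>w | w \<in> W n \<and> heavy \<beta> n (code w). mass w)"
      unfolding P_def using heavy finite_words[of b n] by (intro sum_mono2) auto
    finally show ?case .
  qed
  with \<open>p > 0\<close> show ?thesis by blast
qed

text \<open>
  The bound localizes to every cube: inside of \<open>code u\<close> the measure looks, up to the factor \<open>C\<close>, like a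
  rescaled copy of itself. The price is a constant depending on \<open>u\<close> and a shift of the generation by
  \<open>k\<close>; both are absorbed in the long run by replacing a larger \<open>\<beta>'\<close> by \<open>\<beta>\<close>, because \<open>\<theta>\<close> tends to
  infinity. It is important that \<open>p\<close> does not depend on \<open>u\<close>.
\<close>

lemma heavy_mass_within_cube:
  assumes "0 < \<beta>" "\<beta> < 1"
  shows "\<exists>p>0. \<forall>k. \<forall>u\<in>W k. \<forall>\<^sub>F n in sequentially.
    p * mass u \<le> (\<Sum>v | v \<in> W n \<and> heavy \<beta> (k + n) (code (u @ v)). mass (u @ v))"
proof -
  define \<beta>' where "\<beta>' = (1 + \<beta>) / 2"
  have \<beta>': "0 < \<beta>'" "\<beta>' < 1" "\<beta> < \<beta>'" using assms by (auto simp: \<beta>'_def)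
  obtain p where p: "p > 0"
    "\<forall>\<^sub>F n in sequentially. p \<le> (\<Sum>w | w \<in> W n \<and> heavy \<beta>' n (code w). mass w)"
    using heavy_mass[OF \<beta>'(1,2)] by blast
  have "\<forall>\<^sub>F n in sequentially.
      p / C * mass u \<le> (\<Sum>v | v \<in> W n \<and> heavy \<beta> (k + n) (code (u @ v)). mass (u @ v))"
    if u: "u \<in> W k" for k u
  proof (cases "mass u = 0")
    case True
    then show ?thesis by (auto intro!: always_eventually sum_nonneg)
  next
    case False
    then have mu: "mass u > 0" by (simp add: zero_less_measure_iff)
    define g where "g = (\<beta>' - \<beta>) / 2"
    have g: "g > 0" using \<beta>' by (simp add: g_def)
    define c where "c = ln (mass u) - ln C + k * d * ln l"
    have "\<forall>\<^sub>F n in sequentially. - c / (g * ln l) \<le> \<theta> (real n)"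
      using theta_nat_at_top by (auto simp: filterlim_at_top)
    moreover have "\<forall>\<^sub>F n in sequentially. \<beta> * k / g \<le> real n"
      using filterlim_real_sequentially by (auto simp: filterlim_at_top)
    moreover have "\<forall>\<^sub>F n in sequentially. t0 \<le> real n"
      using filterlim_real_sequentially by (auto simp: filterlim_at_top)
    moreover note p(2)
    ultimately show ?thesis
    proof eventually_elim
      case (elim n)
      have npos: "real n > 0" using elim(3) t0_pos by linarith
      have th0: "\<theta> n > 0" using elim(3) theta_pos by simp
      have h: "heavy \<beta> (k + n) (code (u @ v))" if v: "v \<in> W n" "heavy \<beta>' n (code v)" for v
      proof -
        have mv: "mass v > 0" "(\<beta>' * \<theta> n - n * d) * ln l \<le> ln (mass v)"
          using v by (auto simp: heavy_iff_ln)
        have q: "1 / C * (mass u * mass v) \<le> mass (u @ v)" by (rule qb_lower[OF u v(1)])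
        have pos: "1 / C * (mass u * mass v) > 0" using mu mv C1 by simp
        then have muv: "mass (u @ v) > 0" using q by linarith
        have "ln (1 / C * (mass u * mass v)) \<le> ln (mass (u @ v))"
          using q pos by (intro ln_mono)
        moreover have "ln (1 / C * (mass u * mass v)) = ln (mass u) - ln C + ln (mass v)"
          using mu mv C1 by (simp add: ln_mult ln_div)
        ultimately have 1: "ln (mass u) - ln C + (\<beta>' * \<theta> n - n * d) * ln l \<le> ln (mass (u @ v))"
          using mv by linarith
        have "\<theta> ((real (k + n) / n) * n) \<le> (real (k + n) / n) * \<theta> n"
          using elim npos by (intro theta_scale) auto
        then have "\<beta> * \<theta> (real (k + n)) \<le> \<beta> * ((real (k + n) / n) * \<theta> n)"
          using npos assms by (intro mult_left_mono) auto
        also have "\<dots> = \<beta> * \<theta> n + (\<beta> * k / n) * \<theta> n" using npos by (simp add: field_simps)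
        also have "(\<beta> * k / n) * \<theta> n \<le> g * \<theta> n"
          using elim(2) npos g th0 by (intro mult_right_mono) (auto simp: field_simps)
        finally have "\<beta> * \<theta> (real (k + n)) \<le> (\<beta>' - g) * \<theta> n"
          by (simp add: g_def field_simps)
        then have "\<beta> * \<theta> (real (k + n)) * ln l \<le> (\<beta>' - g) * \<theta> n * ln l"
          using lnl by (intro mult_right_mono) auto
        moreover have "- c \<le> g * \<theta> n * ln l"
          using elim(1) g lnl pos_divide_le_eq[of "g * ln l" "- c" "\<theta> n"] by (simp add: mult_ac)
        ultimately have "(\<beta> * \<theta> (real (k + n)) - real (k + n) * d) * ln l \<le> ln (mass (u @ v))"
          using 1 unfolding c_def by (simp add: algebra_simps)
        then show ?thesis using muv by (simp add: heavy_iff_ln)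
      qed
      have "p / C * mass u \<le> (\<Sum>w | w \<in> W n \<and> heavy \<beta>' n (code w). mass w) / C * mass u"
        using elim(4) C1 by (intro mult_right_mono divide_right_mono) auto
      also have "\<dots> = (\<Sum>v | v \<in> W n \<and> heavy \<beta>' n (code v). 1 / C * (mass u * mass v))"
        by (simp add: sum_distrib_left sum_divide_distrib mult_ac)
      also have "\<dots> \<le> (\<Sum>v | v \<in> W n \<and> heavy \<beta>' n (code v). mass (u @ v))"
        by (intro sum_mono qb_lower[OF u]) auto
      also have "\<dots> \<le> (\<Sum>v | v \<in> W n \<and> heavy \<beta> (k + n) (code (u @ v)). mass (u @ v))"
        using h finite_words[of b n] by (intro sum_mono2) auto
      finally show ?case .
    qed
  qed
  moreover have "p / C > 0" using p C1 by simp
  ultimately show ?thesis by blast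
qed

section \<open>The lower limit\<close>

definition heavy_set :: "real \<Rightarrow> nat \<Rightarrow> (real^'D) set" where
  "heavy_set \<beta> n = \<Union> {I \<in> adic_cubes l n. heavy \<beta> n I}"

lemma heavy_set_measurable[measurable]: "heavy_set \<beta> n \<in> sets m"
  unfolding heavy_set_def using finite_adic_cubes[of n] sets_adic
  by (intro sets.finite_Union) auto

definition often_heavy :: "real \<Rightarrow> (real^'D) set" where
  "often_heavy \<beta> = (\<Inter>N. \<Union>n\<in>{N..}. heavy_set \<beta> n)"

lemma often_heavy_measurable[measurable]: "often_heavy \<beta> \<in> sets m"
  unfolding often_heavy_def by measurable

text \<open>
  Heavy cubes carry at least the fraction \<open>p\<close> of any given cube at all late generations, and so does
  the upper limit of their unions. As \<open>p\<close> is the same for all cubes, the density criterion applies.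
\<close>

lemma often_heavy_measure:
  assumes "0 < \<beta>" "\<beta> < 1"
  shows "measure m (often_heavy \<beta>) = 1"
proof -
  obtain p where p: "p > 0" "\<And>k u. u \<in> W k \<Longrightarrow> \<forall>\<^sub>F n in sequentially.
    p * mass u \<le> (\<Sum>v | v \<in> W n \<and> heavy \<beta> (k + n) (code (u @ v)). mass (u @ v))"
    using heavy_mass_within_cube[OF assms] by blast
  have "p * mass u \<le> measure m (often_heavy \<beta> \<inter> code u)" if u: "u \<in> W k" for u k
  proof -
    define G where "G N = (\<Union>n\<in>{N..}. heavy_set \<beta> n) \<inter> code u" for N
    have G: "G N \<in> sets m" for N unfolding G_def using u by measurable
    have "p * mass u \<le> measure m (G N)" for N
    proof -
      have "\<forall>\<^sub>F n in sequentially. N \<le> n \<and>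
          p * mass u \<le> (\<Sum>v | v \<in> W n \<and> heavy \<beta> (k + n) (code (u @ v)). mass (u @ v))"
        using p(2)[OF u] eventually_ge_at_top[of N] by eventually_elim simp
      then obtain n where n: "N \<le> n"
          "p * mass u \<le> (\<Sum>v | v \<in> W n \<and> heavy \<beta> (k + n) (code (u @ v)). mass (u @ v))"
        using eventually_happens by force
      define V where "V = {v \<in> W n. heavy \<beta> (k + n) (code (u @ v))}"
      have sub: "(\<lambda>v. u @ v) ` V \<subseteq> W (k + n)" using u by (auto simp: V_def words_def)
      have "(\<Sum>v\<in>V. mass (u @ v)) = (\<Sum>w\<in>(\<lambda>v. u @ v) ` V. mass w)"
        by (subst sum.reindex) (auto simp: inj_on_def)
      also have "\<dots> = measure m (\<Union>w\<in>(\<lambda>v. u @ v) ` V. code w)"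
        by (rule measure_UN_code[OF sub, symmetric])
      also have "\<dots> \<le> measure m (G N)"
      proof (rule finite_measure_mono[OF _ G], rule UN_least)
        fix w assume "w \<in> (\<lambda>v. u @ v) ` V"
        then obtain v where v: "v \<in> W n" "heavy \<beta> (k + n) (code w)" "w = u @ v"
          by (auto simp: V_def)
        then have "w \<in> W (k + n)" using u by (auto simp: words_def)
        then have "code w \<subseteq> heavy_set \<beta> (k + n)" using v code_adic by (auto simp: heavy_set_def)
        moreover have "code w \<subseteq> code u" using code_append_subset[OF u v(1)] v(3) by simp
        ultimately show "code w \<subseteq> G N" using n(1) unfolding G_def by force
      qed
      finally show ?thesis using n(2) by (simp add: V_def)
    qed
    moreover have "(\<lambda>N. measure m (G N)) \<longlonglongrightarrow> measure m (\<Inter>N. G N)"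
      using G by (intro finite_Lim_measure_decseq) (force simp: G_def decseq_def)+
    moreover have "(\<Inter>N. G N) = often_heavy \<beta> \<inter> code u" by (auto simp: G_def often_heavy_def)
    ultimately show ?thesis by (intro LIMSEQ_le_const[of "\<lambda>N. measure m (G N)"]) auto
  qed
  then show ?thesis using p(1) by (intro full_measure_of_cube_density) auto
qed

lemma liminf_of_often_heavy:
  assumes "x \<in> often_heavy \<beta>"
  shows "liminf (\<lambda>n. ereal ((log_mass l m n x - real n * d) / \<theta> n)) \<le> - \<beta>"
proof (rule ccontr)
  assume "\<not> ?thesis"
  then have "ereal (- \<beta>) < liminf (\<lambda>n. ereal ((log_mass l m n x - real n * d) / \<theta> n))"
    by (simp add: not_le)
  then have "\<forall>\<^sub>F n in sequentially. ereal (- \<beta>) < ereal ((log_mass l m n x - real n * d) / \<theta> n)"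
    using le_Liminf_iff[of "liminf (\<lambda>n. ereal ((log_mass l m n x - real n * d) / \<theta> n))"
        sequentially "\<lambda>n. ereal ((log_mass l m n x - real n * d) / \<theta> n)"] by auto
  moreover have "\<forall>\<^sub>F n in sequentially. t0 \<le> real n"
    using filterlim_real_sequentially by (auto simp: filterlim_at_top)
  ultimately obtain N where N: "\<And>n. n \<ge> N \<Longrightarrow> - \<beta> < (log_mass l m n x - real n * d) / \<theta> n"
      "\<And>n. n \<ge> N \<Longrightarrow> t0 \<le> real n"
    unfolding eventually_sequentially by (metis ereal_less(2) less_ereal.simps(1) nat_le_linear order_trans)
  obtain n I where n: "n \<ge> N" and I: "I \<in> adic_cubes l n" "heavy \<beta> n I" "x \<in> I"
    using assms by (force simp: often_heavy_def heavy_set_def)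
  have th: "\<theta> n > 0" using theta_pos N(2) n by simp
  have "cube_at l n x = I" by (rule cube_at_eq[OF l0 I(1,3)])
  then have "log_mass l m n x = - (ln (measure m I) / ln l)" by (simp add: log_mass_def log_def)
  moreover have "\<beta> * \<theta> n - n * d \<le> ln (measure m I) / ln l"
    using I(2) lnl by (simp add: heavy_iff_ln pos_le_divide_eq)
  ultimately have "log_mass l m n x - n * d \<le> (- \<beta>) * \<theta> n" by simp
  then have "(log_mass l m n x - n * d) / \<theta> n \<le> - \<beta>" using th by (simp add: pos_divide_le_eq)
  then show False using N(1)[OF n] by simp
qed

lemma AE_liminf_le:
  "AE x in m. liminf (\<lambda>n. ereal ((log_mass l m n x - real n * d) / \<theta> n)) \<le> -1"
proof -
  define \<beta> where "\<beta> k = 1 - 1 / (real k + 2)" for k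
  have \<beta>: "0 < \<beta> k" "\<beta> k < 1" for k by (auto simp: \<beta>_def)
  have lim: "(\<lambda>k. - \<beta> k) \<longlonglongrightarrow> -1"
    unfolding \<beta>_def by real_asymp
  have "AE x in m. \<forall>k. x \<in> often_heavy (\<beta> k)"
    unfolding AE_all_countable
    using often_heavy_measure[OF \<beta>] AE_in_set_eq_1[OF often_heavy_measurable] by blast
  then show ?thesis
  proof eventually_elim
    case (elim x)
    then have "liminf (\<lambda>n. ereal ((log_mass l m n x - real n * d) / \<theta> n)) \<le> ereal (- \<beta> k)" for k
      using liminf_of_often_heavy by simp
    moreover have "(\<lambda>k. ereal (- \<beta> k)) \<longlonglongrightarrow> ereal (-1)" using lim by (intro tendsto_ereal)
    ultimately have "liminf (\<lambda>n. ereal ((log_mass l m n x - real n * d) / \<theta> n)) \<le> ereal (-1)"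
      by (intro LIMSEQ_le_const[of "\<lambda>k. ereal (- \<beta> k)"]) blast+
    then show ?case by (simp add: one_ereal_def)
  qed
qed

section \<open>Singularity\<close>

text \<open>
  This is the gauge function \<open>\<psi>\<^sub>a\<close>; the value \<open>a = 0\<close> gives the power \<open>t powr d\<close>.
\<close>

definition gauge :: "real \<Rightarrow> real \<Rightarrow> real" where
  "gauge a t = t powr d * real l powr (a * \<theta> (log (real l) (1 / t)))"

text \<open>
  At a cube of generation \<open>n\<close> the gauge is about \<open>l powr (a * \<theta> n - n * d)\<close>, whereas a heavy cube has
  measure at least \<open>l powr (\<beta> * \<theta> n - n * d)\<close>. The surplus \<open>l powr ((\<beta> - a) * \<theta> n)\<close> beats any constant,
  in particular the power of the diameter of the unit cube.
\<close>

lemma gauge_le_heavy: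
  assumes "0 \<le> a" "a < \<beta>" "\<delta> > 0"
  shows "\<forall>\<^sub>F n in sequentially. \<forall>I\<in>adic_cubes l n. heavy \<beta> n I \<longrightarrow>
    gauge a (diameter I) \<le> \<delta> * measure m I"
proof -
  define D where "D = sqrt (CARD('D))"
  have D: "D \<ge> 1" by (simp add: D_def)
  \<comment> \<open>The argument of \<theta> is shifted by c because a cube of generation n has diameter D / l^n.\<close>
  define c where "c = log l D"
  have c: "c \<ge> 0" using D l2 by (simp add: c_def)
  have "\<forall>\<^sub>F n in sequentially. t0 + c \<le> real n"
    using filterlim_real_sequentially by (auto simp: filterlim_at_top)
  moreover have "\<forall>\<^sub>F n in sequentially. (d * ln D - ln \<delta>) / ((\<beta> - a) * ln l) \<le> \<theta> (real n)"
    using theta_nat_at_top by (auto simp: filterlim_at_top)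
  ultimately show ?thesis
  proof eventually_elim
    case (elim n)
    show ?case
    proof (intro ballI impI)
      fix I :: "(real^'D) set" assume I: "I \<in> adic_cubes l n" "heavy \<beta> n I"
      have diam: "diameter I = D / real l ^ n"
        using I diameter_adic_cube[OF l0] by (auto simp: adic_cubes_def D_def)
      have "log l (1 / diameter I) = n - c"
        using D l2 by (simp add: diam c_def log_divide log_nat_power)
      then have "\<theta> (log l (1 / diameter I)) \<le> \<theta> n"
        using elim(1) c by (simp add: theta_mono)
      then have *: "a * \<theta> (log l (1 / diameter I)) * ln l \<le> a * \<theta> n * ln l"
        using assms lnl by (intro mult_right_mono mult_left_mono) auto
      have **: "d * ln D - ln \<delta> \<le> (\<beta> - a) * \<theta> n * ln l"
        using elim(2) assms lnl pos_divide_le_eq[of "(\<beta> - a) * ln l" "d * ln D - ln \<delta>" "\<theta> n"]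
        by (simp add: mult_ac)
      have pos: "measure m I > 0" and hv: "(\<beta> * \<theta> n - n * d) * ln l \<le> ln (measure m I)"
        using I(2) by (auto simp: heavy_iff_ln)
      have gpos: "gauge a (diameter I) > 0" using D l0 by (simp add: gauge_def diam)
      have "ln (gauge a (diameter I))
          = d * (ln D - n * ln l) + a * \<theta> (log l (1 / diameter I)) * ln l"
        using D l0 by (simp add: gauge_def ln_mult ln_powr diam ln_div ln_realpow)
      also have "\<dots> \<le> ln \<delta> + ln (measure m I)"
        using * ** hv by (simp add: algebra_simps)
      also have "\<dots> = ln (\<delta> * measure m I)" using assms pos by (simp add: ln_mult)
      finally show "gauge a (diameter I) \<le> \<delta> * measure m I"
        using gpos assms pos by simp
    qed
  qed
qed

text \<open>
  The cover consists of the heavy cubes of generation at least \<open>N\<close> that lie in no heavy cube of an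
  earlier such generation. Two of them never overlap, so that their measures add up to at most one and
  no information on the growth of \<open>\<theta>\<close> is needed to sum over the generations.
\<close>

lemma hausdorff_premeasure_often_heavy:
  assumes "0 \<le> a" "a < \<beta>" "\<eta> > 0"
  shows "hausdorff_premeasure (gauge a) \<eta> (often_heavy \<beta>) = 0"
proof -
  have "hausdorff_premeasure (gauge a) \<eta> (often_heavy \<beta>) \<le> ennreal \<delta>" if \<delta>: "\<delta> > 0" for \<delta>
  proof -
    have "(\<lambda>n. sqrt (CARD('D)) / real l ^ n) \<longlonglongrightarrow> 0"
      using l2 by (intro LIMSEQ_divide_realpow_zero) auto
    then have "\<forall>\<^sub>F n in sequentially. sqrt (CARD('D)) / real l ^ n < \<eta>"
      using assms(3) by (rule order_tendstoD)
    with gauge_le_heavy[OF assms(1,2) \<delta>] have "\<forall>\<^sub>F n in sequentially.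
      sqrt (CARD('D)) / real l ^ n < \<eta> \<and>
      (\<forall>I\<in>adic_cubes l n. heavy \<beta> n I \<longrightarrow> gauge a (diameter I) \<le> \<delta> * measure m I)"
      by eventually_elim simp
    then obtain N where N: "\<And>n. n \<ge> N \<Longrightarrow> sqrt (CARD('D)) / real l ^ n < \<eta>"
      "\<And>n I. n \<ge> N \<Longrightarrow> I \<in> adic_cubes l n \<Longrightarrow> heavy \<beta> n I \<Longrightarrow>
        gauge a (diameter I) \<le> \<delta> * measure m I"
      unfolding eventually_sequentially by blast
    define \<U> where "\<U> = {I. \<exists>n\<ge>N. I \<in> adic_cubes l n \<and> heavy \<beta> n I \<and> (\<forall>j\<in>{N..<n}.
      \<forall>J\<in>adic_cubes l j. heavy \<beta> j J \<longrightarrow> \<not> I \<subseteq> J)}"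
    have disj: "I = J" if "I \<in> \<U>" "J \<in> \<U>" "I \<inter> J \<noteq> {}" for I J
    proof -
      have *: "I = J" if "n \<le> k" "N \<le> n" "I \<in> adic_cubes l n" "heavy \<beta> n I"
        "J \<in> adic_cubes l k" "\<forall>j\<in>{N..<k}. \<forall>J'\<in>adic_cubes l j. heavy \<beta> j J' \<longrightarrow> \<not> J \<subseteq> J'"
        "I \<inter> J \<noteq> {}" for n k I J
      proof (cases "n = k")
        case True then show ?thesis using that adic_cubes_unique[OF l0, of I n J] by blast
      next
        case False
        have "J \<subseteq> I" using that by (intro adic_cubes_nested[of I n J k]) auto
        then show ?thesis using that False by force
      qed
      from that(1) obtain n where n: "N \<le> n" "I \<in> adic_cubes l n" "heavy \<beta> n I"
        "\<forall>j\<in>{N..<n}. \<forall>J'\<in>adic_cubes l j. heavy \<beta> j J' \<longrightarrow> \<not> I \<subseteq> J'"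
        unfolding \<U>_def by blast
      from that(2) obtain k where k: "N \<le> k" "J \<in> adic_cubes l k" "heavy \<beta> k J"
        "\<forall>j\<in>{N..<k}. \<forall>J'\<in>adic_cubes l j. heavy \<beta> j J' \<longrightarrow> \<not> J \<subseteq> J'"
        unfolding \<U>_def by blast
      show ?thesis
      proof (cases "n \<le> k")
        case True
        then show ?thesis using *[OF True n(1-3) k(2,4)] that(3) by blast
      next
        case False
        then have "k \<le> n" by simp
        then show ?thesis using *[OF _ k(1-3) n(2,4)] that(3) by blast
      qed
    qed
    have "\<U> \<subseteq> (\<Union>n. adic_cubes l n)" by (auto simp: \<U>_def)
    then have "countable \<U>"
      by (rule countable_subset) (intro countable_UN countable_finite finite_adic_cubes countableI_type)
    moreover have "often_heavy \<beta> \<subseteq> \<Union>\<U>"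
    proof
      fix x assume x: "x \<in> often_heavy \<beta>"
      define Q where "Q n \<longleftrightarrow> N \<le> n \<and> x \<in> heavy_set \<beta> n" for n
      have "\<exists>n. Q n" using x by (auto simp: often_heavy_def Q_def)
      then obtain n where n: "Q n" "\<And>j. j < n \<Longrightarrow> \<not> Q j" by (metis exists_least_iff)
      then obtain I where I: "I \<in> adic_cubes l n" "heavy \<beta> n I" "x \<in> I"
        by (auto simp: Q_def heavy_set_def)
      have "\<not> I \<subseteq> J" if "j \<in> {N..<n}" "J \<in> adic_cubes l j" "heavy \<beta> j J" for j J
        using n(2)[of j] that I(3) by (auto simp: Q_def heavy_set_def)
      then have "I \<in> \<U>" using I n(1) unfolding \<U>_def Q_def by blast
      then show "x \<in> \<Union>\<U>" using I by blast
    qed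
    moreover have "bounded U \<and> 0 < diameter U \<and> diameter U \<le> \<eta>" if U: "U \<in> \<U>" for U
    proof -
      obtain n k where "n \<ge> N" "U = adic_cube l n k"
        using U by (auto simp: \<U>_def adic_cubes_def)
      then show ?thesis
        using bounded_adic_cube diameter_adic_cube[OF l0, where n = n and k = k] N(1)[of n] l0
        by simp
    qed
    ultimately have "hausdorff_premeasure (gauge a) \<eta> (often_heavy \<beta>)
        \<le> (\<Sum>\<^sub>\<infinity>U\<in>\<U>. ennreal (gauge a (diameter U)))"
      unfolding hausdorff_premeasure_def by (intro INF_lower) auto
    also have "\<dots> = (SUP F\<in>{F. F \<subseteq> \<U> \<and> finite F}. \<Sum>U\<in>F. ennreal (gauge a (diameter U)))"
      by (subst nonneg_infsum_complete) (auto simp: conj_commute)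
    also have "\<dots> \<le> ennreal \<delta>"
    proof (rule SUP_least)
      fix F assume "F \<in> {F. F \<subseteq> \<U> \<and> finite F}"
      then have F: "F \<subseteq> \<U>" "finite F" by auto
      have Fs: "F \<subseteq> sets m" using F(1) sets_adic by (auto simp: \<U>_def)
      have "(\<Sum>U\<in>F. ennreal (gauge a (diameter U))) \<le> (\<Sum>U\<in>F. ennreal (\<delta> * measure m U))"
        using F(1) N(2) by (intro sum_mono ennreal_leI) (auto simp: \<U>_def)
      also have "\<dots> = ennreal (\<delta> * (\<Sum>U\<in>F. measure m U))"
        using \<delta> by (simp add: sum_ennreal sum_distrib_left)
      also have "(\<Sum>U\<in>F. measure m U) = measure m (\<Union>U\<in>F. U)"
      proof (intro finite_measure_finite_Union[symmetric])
        show "disjoint_family_on (\<lambda>U. U) F"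
          unfolding disjoint_family_on_def using F(1) disj by blast
      qed (use F Fs in auto)
      also have "ennreal (\<delta> * measure m (\<Union>U\<in>F. U)) \<le> ennreal (\<delta> * 1)"
        using \<delta> by (intro ennreal_leI mult_left_mono prob_le_1) auto
      finally show "(\<Sum>U\<in>F. ennreal (gauge a (diameter U))) \<le> ennreal \<delta>" by simp
    qed
    finally show ?thesis .
  qed
  then have "hausdorff_premeasure (gauge a) \<eta> (often_heavy \<beta>) \<le> 0 + ennreal \<delta>" if "\<delta> > 0" for \<delta>
    unfolding add_0_left using that by blast
  then have "hausdorff_premeasure (gauge a) \<eta> (often_heavy \<beta>) \<le> 0"
    by (rule ennreal_le_epsilon)
  then show ?thesis by (simp only: le_zero_eq)
qed

lemma hausdorff_singular_gauge:
  assumes "0 \<le> a" "a < 1"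
  shows "hausdorff_singular m (gauge a)"
proof -
  define \<beta> where "\<beta> = (1 + a) / 2"
  have \<beta>: "0 < \<beta>" "\<beta> < 1" "a < \<beta>" using assms by (auto simp: \<beta>_def)
  have "\<forall>\<^sub>F \<eta> in at_right 0. hausdorff_premeasure (gauge a) \<eta> (often_heavy \<beta>) = 0"
    using eventually_at_right_less
    by eventually_elim (rule hausdorff_premeasure_often_heavy[OF assms(1) \<beta>(3)])
  then have "((\<lambda>\<eta>. hausdorff_premeasure (gauge a) \<eta> (often_heavy \<beta>)) \<longlongrightarrow> 0) (at_right 0)"
    by (rule tendsto_eventually)
  then have "hausdorff_measure (gauge a) (often_heavy \<beta>) = 0"
    unfolding hausdorff_measure_def by (intro tendsto_Lim) auto
  then show ?thesis
    unfolding hausdorff_singular_def using often_heavy_measure[OF \<beta>(1,2)] often_heavy_measurable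
    by blast
qed

end

theorem theorem4p12:
  fixes l :: nat
    and code :: "nat list \<Rightarrow> (real^'D) set"
    and m :: "(real^'D) measure"
    and d :: real
  assumes "l \<ge> 2"
    and "cube_coding l code"
    and "quasi_bernoulli l code m"
    and "d = measure_dim l m"
    and "\<exists>C>0. \<forall>q\<in>{-1..<0}. 0 < chi l m q \<and> chi l m q \<le> C * chi l m (q / 2)"
  shows "(AE x in m. liminf (\<lambda>n. ereal ((log_mass l m n x - real n * d) / theta l m (real n))) \<le> -1) \<and>
    (\<forall>a. 0 < a \<and> a < 1 \<longrightarrow>
       hausdorff_singular m (\<lambda>t. t powr d * real l powr (a * theta l m (log (real l) (1 / t))))) \<and>
    hausdorff_singular m (\<lambda>t. t powr d)"
proof -
  obtain C where C: "C \<ge> 1" "\<And>n p u v. u \<in> words (l ^ CARD('D)) n \<Longrightarrow> v \<in> words (l ^ CARD('D)) p \<Longrightarrow>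
        1 / C * measure m (code u) * measure m (code v) \<le> measure m (code (u @ v)) \<and>
        measure m (code (u @ v)) \<le> C * measure m (code u) * measure m (code v)"
    using assms(3) unfolding quasi_bernoulli_def by blast
  obtain K where K: "\<And>q. q \<in> {-1..<0} \<Longrightarrow> 0 < chi l m q \<and> chi l m q \<le> K * chi l m (q / 2)"
    using assms(5) by blast
  interpret prob_space m using assms(3) by (simp add: quasi_bernoulli_def)
  interpret doubling_quasi_bernoulli m l code "l ^ CARD('D)" C K
    by unfold_locales
      (use assms(1-3) C K in \<open>auto simp: quasi_bernoulli_def mult.assoc[symmetric] simp del: mult_1\<close>)
  have "hausdorff_singular m (\<lambda>t. t powr d * real l powr (a * theta l m (log (real l) (1 / t))))"
    if "0 \<le> a" "a < 1" for a
    using hausdorff_singular_gauge[OF that] by (simp add: gauge_def[abs_def] assms(4))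
  from this this[of 0] show ?thesis
    using AE_liminf_le l0 by (simp add: assms(4))
qed

end
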